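(* If $G$ is a (claw, even-hole)-free graph with $n$ vertices, then $c(G)\le 2$ and the capture time of $G$ is at most $2n$.
   Context: A claw is the star $K_{1,3}$; a hole is an induced cycle of length at least $4$; an even hole is a hole of even length; (claw, even-hole)-free means no induced claw and no even hole. Game of cops and robber on a connected graph: in the first round the cops choose their starting vertices, then the robber chooses his; afterwards, in each round, first every cop either stays or moves to an adjacent vertex, then the robber either stays or moves to an adjacent vertex. The cops win when some cop occupies the robber's vertex. The cop number $c(G)$ of a connected graph is the minimum number $k$ of cops having a winning strategy; for a disconnected graph it is the maximum of the cop numbers of its components. For a graph with $c(G)=k$, the capture time is the minimum $t$ such that $k$ cops can always capture the robber within $t$ rounds regardless of the robber's play. *)

theory Defs
  imports "Graph_Theory.Graph_Theory" "HOL-Library.Extended_Nat"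
begin

text \<open>
  Finite simple graphs are the symmetric digraphs of the locale \<^locale>\<open>graph\<close>; since they are
  symmetric, their connected components are the strongly connected components
  \<^const>\<open>pre_digraph.sccs\<close>.
\<close>

definition claw_free :: "('a, 'b) pre_digraph \<Rightarrow> bool" where
  "claw_free G \<equiv> \<not> (\<exists>H. induced_subgraph H G \<and> K\<^bsub>1,3\<^esub> H)"

text \<open>
  A cycle is represented by its list of arcs, so its length is the length of that list and its
  vertices are the tails of its arcs. The last conjunct says that the cycle is induced (chordless).
\<close>

definition hole :: "('a, 'b) pre_digraph \<Rightarrow> 'b list \<Rightarrow> bool" where
  "hole G p \<equiv> pre_digraph.cycle G p \<and> 4 \<le> length p \<and>
     arcs_ends (G \<restriction> (tail G ` set p))
       \<subseteq> arc_to_ends G ` set p \<union> (arc_to_ends G ` set p)\<inverse>"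

definition even_hole_free :: "('a, 'b) pre_digraph \<Rightarrow> bool" where
  "even_hole_free G \<equiv> \<not> (\<exists>p. hole G p \<and> even (length p))"

definition stay_or_move :: "('a, 'b) pre_digraph \<Rightarrow> 'a \<Rightarrow> 'a \<Rightarrow> bool" where
  "stay_or_move G u v \<equiv> u \<in> verts G \<and> v \<in> verts G \<and> (u = v \<or> u \<rightarrow>\<^bsub>G\<^esub> v)"

text \<open>
  Rounds are numbered from 0 here, round 0 being the round in which the starting vertices are
  chosen. A play of the robber is the sequence of his positions, \<open>r i\<close> being his position at the
  end of round \<open>i\<close>.
\<close>

definition robber_play :: "('a, 'b) pre_digraph \<Rightarrow> (nat \<Rightarrow> 'a) \<Rightarrow> bool" where
  "robber_play G r \<equiv> \<forall>i. stay_or_move G (r i) (r (Suc i))"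

text \<open>
  A strategy maps the list of the robber's positions in all previous rounds to the list of the
  cops' positions in the current round (an earlier position of the cops is itself determined by
  the strategy and by the robber's play up to then).
\<close>

definition cop_positions :: "('a list \<Rightarrow> 'a list) \<Rightarrow> (nat \<Rightarrow> 'a) \<Rightarrow> nat \<Rightarrow> 'a list" where
  "cop_positions \<sigma> r i = \<sigma> (map r [0..<i])"

definition cop_strategy ::
    "('a, 'b) pre_digraph \<Rightarrow> nat \<Rightarrow> ('a list \<Rightarrow> 'a list) \<Rightarrow> bool" where
  "cop_strategy G k \<sigma> \<equiv> \<forall>r. robber_play G r \<longrightarrow>
     length (cop_positions \<sigma> r 0) = k \<and> set (cop_positions \<sigma> r 0) \<subseteq> verts G \<and>
     (\<forall>i. list_all2 (stay_or_move G) (cop_positions \<sigma> r i) (cop_positions \<sigma> r (Suc i)))"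

text \<open>
  The robber can be caught in a round either by the cops' move, while he is still at his position
  of the preceding round, or because his own choice puts or leaves him on a vertex held by a cop.
\<close>

definition caught_in_round :: "('a list \<Rightarrow> 'a list) \<Rightarrow> (nat \<Rightarrow> 'a) \<Rightarrow> nat \<Rightarrow> bool" where
  "caught_in_round \<sigma> r i \<equiv>
     (0 < i \<and> r (i - 1) \<in> set (cop_positions \<sigma> r i)) \<or> r i \<in> set (cop_positions \<sigma> r i)"

definition cops_win :: "('a, 'b) pre_digraph \<Rightarrow> nat \<Rightarrow> bool" where
  "cops_win G k \<equiv> \<exists>\<sigma>. cop_strategy G k \<sigma> \<and>
     (\<forall>r. robber_play G r \<longrightarrow> (\<exists>i. caught_in_round \<sigma> r i))"

text \<open>
  The placement round counts, so ``within \<open>t\<close> rounds'' means in one of the rounds \<open>0, \<dots>, t - 1\<close>.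
\<close>

definition cops_win_within :: "('a, 'b) pre_digraph \<Rightarrow> nat \<Rightarrow> nat \<Rightarrow> bool" where
  "cops_win_within G k t \<equiv> \<exists>\<sigma>. cop_strategy G k \<sigma> \<and>
     (\<forall>r. robber_play G r \<longrightarrow> (\<exists>i<t. caught_in_round \<sigma> r i))"

text \<open>
  Minima are taken in \<^typ>\<open>enat\<close>: the minimum of the empty set is \<open>\<infinity>\<close>, not an arbitrary number.
\<close>

definition connected_cop_number :: "('a, 'b) pre_digraph \<Rightarrow> enat" where
  "connected_cop_number G = Inf {enat k |k. cops_win G k}"

definition connected_capture_time :: "('a, 'b) pre_digraph \<Rightarrow> enat" where
  "connected_capture_time G =
     Inf {enat t |t k. connected_cop_number G = enat k \<and> cops_win_within G k t}"

definition cop_number :: "('a, 'b) pre_digraph \<Rightarrow> enat" where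
  "cop_number G = (SUP H \<in> pre_digraph.sccs G. connected_cop_number H)"

text \<open>
  As for the cop number, the capture time of a disconnected graph is the maximum over its
  components, each component being played with as many cops as its own cop number. This is at
  least the time needed when every component is played with \<open>cop_number G\<close> cops.
\<close>

definition capture_time :: "('a, 'b) pre_digraph \<Rightarrow> enat" where
  "capture_time G = (SUP H \<in> pre_digraph.sccs G. connected_capture_time H)"

end

theory Submission
  imports Defs
begin

text \<open>
  Two cops at \<open>a\<close> and \<open>b\<close> confine the robber to a connected set \<open>R\<close> outside their neighbourhoods
  whose boundary they dominate, while \<open>a\<close> and \<open>b\<close> are joined by a walk of length \<open>d\<close> that avoids
  \<open>R\<close> and its boundary. Every round decreases \<open>2 |R| + d\<close>. If both cops are needed to dominate the
  boundary, the vertices that only one of them dominates form a clique: otherwise a hole through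
  \<open>R\<close>, a triangle on one of its edges and the walk to the other cop produce a prism-like
  configuration, hence an even hole or a claw. So that cop may step onto a vertex of the clique,
  which shrinks \<open>R\<close>. If one cop suffices, he steps onto the boundary when it is a clique; otherwise
  the other cop walks up to him, and from a common vertex they step onto two nonadjacent boundary
  vertices, which dominate the boundary because there is no claw and have no common neighbour in
  \<open>R\<close> because there is no hole of length 4.

  The capture time also has to be bounded for components in which a single cop wins. These are
  dismantlable, and undoing the removal of one corner costs one round.
\<close>

section \<open>Induced paths and cycles\<close>

text \<open>Only pairs \<open>i < j\<close> are tested, so the notion is meant for symmetric
  \<open>E\<close>.\<close>

definition induced_path :: "('a \<Rightarrow> 'a \<Rightarrow> bool) \<Rightarrow> 'a list \<Rightarrow> bool" where
  "induced_path E xs \<longleftrightarrow> distinct xs \<and>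
     (\<forall>i j. i < j \<and> j < length xs \<longrightarrow> (E (xs ! i) (xs ! j) \<longleftrightarrow> j = Suc i))"

definition induced_cycle :: "('a \<Rightarrow> 'a \<Rightarrow> bool) \<Rightarrow> 'a list \<Rightarrow> bool" where
  "induced_cycle E xs \<longleftrightarrow> distinct xs \<and> 4 \<le> length xs \<and>
     (\<forall>i j. i < j \<and> j < length xs \<longrightarrow>
        (E (xs ! i) (xs ! j) \<longleftrightarrow> j = Suc i \<or> (i = 0 \<and> Suc j = length xs)))"

text \<open>Its reflexive transitive closure is reachability inside \<open>X\<close>. Reflexivity
  holds even at points outside \<open>X\<close>, hence the separate membership premises
  below.\<close>

definition restr :: "('a \<Rightarrow> 'a \<Rightarrow> bool) \<Rightarrow> 'a set \<Rightarrow> 'a \<Rightarrow> 'a \<Rightarrow> bool" where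
  "restr E X u v \<longleftrightarrow> E u v \<and> u \<in> X \<and> v \<in> X"

section \<open>Truncating, reversing and gluing induced paths\<close>

lemma induced_pathD:
  "induced_path E xs \<Longrightarrow> i < j \<Longrightarrow> j < length xs \<Longrightarrow> E (xs ! i) (xs ! j) \<longleftrightarrow> j = Suc i"
  by (simp add: induced_path_def)

lemma induced_path_take: "induced_path E xs \<Longrightarrow> induced_path E (take n xs)"
  by (auto simp: induced_path_def)

lemma induced_path_drop: "induced_path E xs \<Longrightarrow> induced_path E (drop n xs)"
  by (auto simp: induced_path_def)

lemma induced_path_rev:
  assumes "induced_path E xs" "symp E"
  shows "induced_path E (rev xs)"
  unfolding induced_path_def
proof (intro conjI allI impI)
  show "distinct (rev xs)" using assms(1) by (simp add: induced_path_def)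
next
  fix i j assume ij: "i < j \<and> j < length (rev xs)"
  have "E (xs ! (length xs - Suc j)) (xs ! (length xs - Suc i)) \<longleftrightarrow>
      length xs - Suc i = Suc (length xs - Suc j)"
    using ij by (intro induced_pathD[OF assms(1)]) auto
  moreover have "length xs - Suc i = Suc (length xs - Suc j) \<longleftrightarrow> j = Suc i"
    using ij by auto
  ultimately show "E (rev xs ! i) (rev xs ! j) \<longleftrightarrow> j = Suc i"
    using ij assms(2) by (auto simp: rev_nth dest: sympD)
qed

lemma nth_eq_last_iff:
  "distinct xs \<Longrightarrow> i < length xs \<Longrightarrow> xs ! i = last xs \<longleftrightarrow> Suc i = length xs"
  by (cases xs rule: rev_cases) (auto simp: nth_append in_set_conv_nth)

lemma nth_eq_hd_iff: "distinct xs \<Longrightarrow> i < length xs \<Longrightarrow> xs ! i = hd xs \<longleftrightarrow> i = 0"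
  by (cases xs) (auto simp: nth_Cons split: nat.splits)

lemma induced_path_snoc:
  assumes "induced_path E xs" "a \<notin> set xs" "xs \<noteq> []"
    and "\<And>x. x \<in> set xs \<Longrightarrow> E x a \<longleftrightarrow> x = last xs"
  shows "induced_path E (xs @ [a])"
  unfolding induced_path_def
proof (intro conjI allI impI)
  show "distinct (xs @ [a])" using assms by (simp add: induced_path_def)
next
  fix i j assume ij: "i < j \<and> j < length (xs @ [a])"
  show "E ((xs @ [a]) ! i) ((xs @ [a]) ! j) \<longleftrightarrow> j = Suc i"
  proof (cases "j < length xs")
    case True
    then show ?thesis using ij assms(1) by (simp add: nth_append induced_path_def)
  next
    case False
    then have j: "j = length xs" and i: "i < length xs" using ij by auto
    have "xs ! i = last xs \<longleftrightarrow> Suc i = length xs"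
      using i assms(1) by (intro nth_eq_last_iff) (simp_all add: induced_path_def)
    then show ?thesis using i j assms(4)[of "xs ! i"] by (auto simp: nth_append)
  qed
qed

text \<open>Two disjoint induced paths joined only at their ends close a hole. A path may be a
  single vertex, whose head and last entry coincide.\<close>

lemma induced_cycle_append:
  assumes "induced_path E xs" "induced_path E ys" "xs \<noteq> []" "ys \<noteq> []"
    and disj: "set xs \<inter> set ys = {}" and len: "4 \<le> length xs + length ys"
    and cross: "\<And>x y. x \<in> set xs \<Longrightarrow> y \<in> set ys \<Longrightarrow>
      E x y \<longleftrightarrow> (x = last xs \<and> y = hd ys) \<or> (x = hd xs \<and> y = last ys)"
  shows "induced_cycle E (xs @ ys)"
  unfolding induced_cycle_def
proof (intro conjI allI impI)
  have d: "distinct xs" "distinct ys" using assms by (simp_all add: induced_path_def)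
  show "distinct (xs @ ys)" using d disj by simp
  show "4 \<le> length (xs @ ys)" using len by simp
  fix i j assume ij: "i < j \<and> j < length (xs @ ys)"
  consider "j < length xs" | "length xs \<le> i" | "i < length xs" "length xs \<le> j" by linarith
  then show "E ((xs @ ys) ! i) ((xs @ ys) ! j) \<longleftrightarrow>
      j = Suc i \<or> (i = 0 \<and> Suc j = length (xs @ ys))"
  proof cases
    case 1
    moreover have "Suc j \<noteq> length xs + length ys" using assms(4) 1 by (cases ys) auto
    ultimately show ?thesis using ij induced_pathD[OF assms(1), of i j] by (auto simp: nth_append)
  next
    case 2
    have "i \<noteq> 0" using 2 assms(3) by (cases xs) auto
    moreover have "E (ys ! (i - length xs)) (ys ! (j - length xs)) \<longleftrightarrow>
        j - length xs = Suc (i - length xs)"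
      using ij 2 by (intro induced_pathD[OF assms(2)]) auto
    moreover have "j - length xs = Suc (i - length xs) \<longleftrightarrow> j = Suc i" using ij 2 by auto
    ultimately show ?thesis using 2 ij by (simp add: nth_append)
  next
    case 3
    define k where "k = j - length xs"
    have k: "k < length ys" "j = length xs + k" using 3 ij by (auto simp: k_def)
    have "xs ! i = last xs \<longleftrightarrow> Suc i = length xs" "xs ! i = hd xs \<longleftrightarrow> i = 0"
      using 3 d by (simp_all add: nth_eq_last_iff nth_eq_hd_iff)
    moreover have "ys ! k = last ys \<longleftrightarrow> Suc k = length ys" "ys ! k = hd ys \<longleftrightarrow> k = 0"
      using k d by (simp_all add: nth_eq_last_iff nth_eq_hd_iff)
    moreover have "E (xs ! i) (ys ! k) \<longleftrightarrow>
       (xs ! i = last xs \<and> ys ! k = hd ys) \<or> (xs ! i = hd xs \<and> ys ! k = last ys)"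
      using 3 k by (intro cross) auto
    moreover have "j = Suc i \<longleftrightarrow> Suc i = length xs \<and> k = 0" "Suc j = length (xs @ ys) \<longleftrightarrow> Suc k = length ys"
      using 3 k by auto
    ultimately show ?thesis using 3 k by (simp add: nth_append)
  qed
qed

section \<open>Reachability inside a vertex set and shortest paths\<close>

lemma rtranclp_restr_mem: "(restr E X)\<^sup>*\<^sup>* x y \<Longrightarrow> x \<in> X \<Longrightarrow> y \<in> X"
  by (induction rule: rtranclp_induct) (auto simp: restr_def)

lemma restr_mono:
  assumes "(restr E X)\<^sup>*\<^sup>* x y" "X \<subseteq> Y"
  shows "(restr E Y)\<^sup>*\<^sup>* x y"
proof -
  have "restr E X \<le> restr E Y" using assms(2) by (auto simp: restr_def)
  from rtranclp_mono[OF this] show ?thesis using assms(1) by auto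
qed

lemma restr_sym:
  assumes "symp E"
  shows "(restr E X)\<^sup>*\<^sup>* x y \<Longrightarrow> (restr E X)\<^sup>*\<^sup>* y x"
proof -
  have "symp (restr E X)" using assms by (auto simp: restr_def intro!: sympI dest: sympD)
  then show "(restr E X)\<^sup>*\<^sup>* x y \<Longrightarrow> (restr E X)\<^sup>*\<^sup>* y x" by (meson sympD symp_rtranclp)
qed

text \<open>Cut the walk at its first vertex in \<open>A\<close>. The induction carries the
  alternative that the walk so far avoids \<open>A\<close> or has already entered it.\<close>

lemma first_entry:
  assumes "(restr E X)\<^sup>*\<^sup>* x y" "x \<in> X" "x \<notin> A" "y \<in> A"
  obtains u v where "(restr E (X - A))\<^sup>*\<^sup>* x u" "u \<in> X - A" "v \<in> X \<inter> A" "E u v"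
proof -
  have "(restr E (X - A))\<^sup>*\<^sup>* x y \<or> (\<exists>u v. (restr E (X - A))\<^sup>*\<^sup>* x u \<and> u \<in> X - A \<and> v \<in> X \<inter> A \<and> E u v)"
    using assms(1)
  proof (induction rule: rtranclp_induct)
    case base then show ?case by simp
  next
    case (step y z)
    show ?case
    proof (cases "(restr E (X - A))\<^sup>*\<^sup>* x y \<and> z \<notin> A")
      case True
      moreover have "y \<in> X - A" using rtranclp_restr_mem[of E "X - A" x y] True assms by auto
      ultimately have "restr E (X - A) y z" using step.hyps(2) by (auto simp: restr_def)
      then show ?thesis using True by (meson rtranclp.rtrancl_into_rtrancl)
    next
      case False
      have "y \<in> X - A" if "(restr E (X - A))\<^sup>*\<^sup>* x y"
        using rtranclp_restr_mem[OF that] assms by auto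
      moreover have "E y z" "z \<in> X" using step.hyps(2) by (auto simp: restr_def)
      ultimately show ?thesis using step.IH False by blast
    qed
  qed
  moreover have "\<not> (restr E (X - A))\<^sup>*\<^sup>* x y"
    using rtranclp_restr_mem[of E "X - A" x y] assms by auto
  ultimately show ?thesis using that by blast
qed

lemma walk_of_restr:
  assumes "(restr E X)\<^sup>*\<^sup>* x y" "x \<in> X"
  shows "\<exists>xs. xs \<noteq> [] \<and> hd xs = x \<and> last xs = y \<and> set xs \<subseteq> X \<and> successively E xs"
  using assms
proof (induction rule: rtranclp_induct)
  case base
  then show ?case by (intro exI[of _ "[x]"]) auto
next
  case (step y z)
  then obtain xs where "xs \<noteq> [] \<and> hd xs = x \<and> last xs = y \<and> set xs \<subseteq> X \<and> successively E xs"
    by auto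
  then show ?case using step.hyps(2)
    by (intro exI[of _ "xs @ [z]"]) (auto simp: restr_def successively_append_iff)
qed

lemma successively_take: "successively E xs \<Longrightarrow> successively E (take n xs)"
  by (simp add: successively_conv_nth)

lemma successively_drop: "successively E xs \<Longrightarrow> successively E (drop n xs)"
  by (simp add: successively_conv_nth)

text \<open>Take a walk of least length from \<open>x\<close> into \<open>T\<close>: a chord, a
  repeated vertex or an earlier vertex of \<open>T\<close> would each yield a shorter one. Its end
  need not be \<open>y\<close>.\<close>

lemma shortest_path:
  assumes "(restr E X)\<^sup>*\<^sup>* x y" "x \<in> X" "y \<in> T"
  obtains xs where "xs \<noteq> []" "hd xs = x" "last xs \<in> T" "set xs \<subseteq> X" "set (butlast xs) \<inter> T = {}"
    "induced_path E xs"
proof -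
  define P where "P xs \<longleftrightarrow> xs \<noteq> [] \<and> hd xs = x \<and> last xs \<in> T \<and> set xs \<subseteq> X \<and> successively E xs" for xs
  have "\<exists>xs. P xs" using walk_of_restr[OF assms(1,2)] assms(3) by (auto simp: P_def)
  then obtain xs where Pxs: "P xs" and min: "\<And>ys. P ys \<Longrightarrow> length xs \<le> length ys"
    using ex_has_least_nat[of P _ length] by blast
  have xs: "xs \<noteq> []" "hd xs = x" "last xs \<in> T" "set xs \<subseteq> X" "successively E xs"
    using Pxs by (auto simp: P_def)
  have shortcut: False if "i < j" "j < length xs" "E (xs ! i) (xs ! j)" "j \<noteq> Suc i" for i j
  proof -
    have "P (take (Suc i) xs @ drop j xs)"
      unfolding P_def
    proof (intro conjI)
      show "set (take (Suc i) xs @ drop j xs) \<subseteq> X"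
        using xs(4) set_take_subset[of "Suc i" xs] set_drop_subset[of j xs] by auto
      show "successively E (take (Suc i) xs @ drop j xs)"
        using that xs(1,5) successively_take[OF xs(5), of "Suc i"] last_conv_nth[of "take (Suc i) xs"]
        by (auto simp: successively_append_iff[of E "take (Suc i) xs"] successively_drop
          hd_drop_conv_nth min_def)
    qed (use that xs in \<open>auto simp: hd_append\<close>)
    from min[OF this] that show False by simp
  qed
  have dist: "xs ! i \<noteq> xs ! j" if "i < j" "j < length xs" for i j
  proof
    assume eq: "xs ! i = xs ! j"
    have "P (take i xs @ drop j xs)"
      unfolding P_def
    proof (intro conjI)
      show "set (take i xs @ drop j xs) \<subseteq> X"
        using xs(4) set_take_subset[of i xs] set_drop_subset[of j xs] by auto
      show "hd (take i xs @ drop j xs) = x"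
        using that eq xs by (cases "i = 0") (auto simp: hd_drop_conv_nth hd_conv_nth[of xs] hd_append)
      have "E (last (take i xs)) (xs ! j)" if "i > 0"
      proof -
        have "E (xs ! (i - 1)) (xs ! i)"
          using xs(5) \<open>i < j\<close> \<open>j < length xs\<close> that by (auto simp: successively_conv_nth dest!: spec[of _ "i - 1"])
        moreover have "last (take i xs) = xs ! (i - 1)"
          using that \<open>i < j\<close> \<open>j < length xs\<close> by (subst last_conv_nth) auto
        ultimately show ?thesis using eq by simp
      qed
      then show "successively E (take i xs @ drop j xs)"
        using that xs(5) by (auto simp: successively_append_iff successively_take successively_drop
          hd_drop_conv_nth)
    qed (use that xs in auto)
    from min[OF this] that show False by simp
  qed
  have "set (butlast xs) \<inter> T = {}"
  proof (rule ccontr)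
    assume "set (butlast xs) \<inter> T \<noteq> {}"
    then obtain i where i: "i < length xs - 1" "xs ! i \<in> T"
      by (auto simp: in_set_conv_nth nth_butlast)
    have "P (take (Suc i) xs)"
      using i xs set_take_subset[of "Suc i" xs]
        successively_take[OF xs(5), of "Suc i"] last_conv_nth[of "take (Suc i) xs"]
      by (auto simp: P_def hd_conv_nth min_def)
    from min[OF this] i show False by simp
  qed
  moreover have "induced_path E xs"
    unfolding induced_path_def
  proof (intro conjI allI impI)
    show "distinct xs"
      using dist by (auto simp: distinct_conv_nth) (metis nat_neq_iff)
    fix i j assume ij: "i < j \<and> j < length xs"
    then show "E (xs ! i) (xs ! j) \<longleftrightarrow> j = Suc i"
      using shortcut[of i j] xs(5) by (auto simp: successively_conv_nth)
  qed
  ultimately show ?thesis using that xs by blast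
qed

section \<open>Holes and boundaries\<close>

text \<open>The combinatorial argument uses only vertices and adjacency; every component of the
  graph becomes an instance.\<close>

locale claw_even_hole_free =
  fixes V :: "'a set" and E :: "'a \<Rightarrow> 'a \<Rightarrow> bool"
  assumes finite_V: "finite V"
    and adj_sym: "symp E"
    and adj_irrefl: "\<not> E x x"
    and adj_V: "E x y \<Longrightarrow> x \<in> V"
    and no_claw: "E c x \<Longrightarrow> E c y \<Longrightarrow> E c z \<Longrightarrow> x \<noteq> y \<Longrightarrow> x \<noteq> z \<Longrightarrow> y \<noteq> z \<Longrightarrow>
      E x y \<or> E x z \<or> E y z"
    and no_even_cycle: "induced_cycle E xs \<Longrightarrow> odd (length xs)"
begin

section \<open>The robber's territory, its boundary, and the holes passing through it\<close>

lemma adj_commute: "E x y \<longleftrightarrow> E y x"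
  using adj_sym by (auto dest: sympD)

lemma adj_V': "E x y \<Longrightarrow> y \<in> V"
  using adj_V adj_commute by blast

definition nbhd :: "'a \<Rightarrow> 'a set" where
  "nbhd v = insert v {u. E v u}"

definition boundary :: "'a set \<Rightarrow> 'a set" where
  "boundary R = {s \<in> V - R. \<exists>r\<in>R. E s r}"

text \<open>These vertices have distance at least two from \<open>R\<close>, so cops standing here,
  and the walk between them, send no edge into \<open>R\<close>.\<close>

definition outside :: "'a set \<Rightarrow> 'a set" where
  "outside R = V - R - boundary R"

definition connected_set :: "'a set \<Rightarrow> bool" where
  "connected_set R \<longleftrightarrow> (\<forall>x\<in>R. \<forall>y\<in>R. (restr E R)\<^sup>*\<^sup>* x y)"

lemma outside_not_adj: "x \<in> outside R \<Longrightarrow> r \<in> R \<Longrightarrow> \<not> E x r \<and> \<not> E r x"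
  using adj_commute by (auto simp: outside_def boundary_def)

text \<open>
  Three vertices \<open>a\<close>, \<open>s = hs ! 0\<close>, \<open>p\<close> form a triangle sitting on the hole \<open>a # hs\<close>, and a path
  \<open>cs\<close> leads from \<open>p\<close> to another vertex attached to the hole. In the absence of claws the two
  cycles closed by the path and the two arcs of the hole cannot both be odd, unless \<open>cs\<close> is a single edge that forms a
  further triangle with \<open>s\<close>.
\<close>
lemma triangle_path_attachment:
  assumes hs: "induced_path E hs" "even (length hs)" "4 \<le> length hs"
    and a: "a \<notin> set hs" "\<And>h. h \<in> set hs \<Longrightarrow> E a h \<longleftrightarrow> h = hd hs \<or> h = last hs"
    and cs: "induced_path E cs" "2 \<le> length cs" "set cs \<inter> set hs = {}" "a \<notin> set cs"
    and cs_a: "\<And>c. c \<in> set cs \<Longrightarrow> E a c \<longleftrightarrow> c = hd cs"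
    and hd_cs: "\<And>h. h \<in> set hs \<Longrightarrow> E (hd cs) h \<longleftrightarrow> h = hd hs"
    and inner: "\<And>c h. c \<in> set cs \<Longrightarrow> c \<noteq> hd cs \<Longrightarrow> c \<noteq> last cs \<Longrightarrow> h \<in> set hs \<Longrightarrow> \<not> E c h"
    and att: "\<exists>h\<in>set hs. E (last cs) h"
  obtains j where "length cs = 2" "E (last cs) (hd hs)" "E (last cs) (hs ! j)"
    "2 \<le> j" "Suc j < length hs"
proof -
  define m where "m = length hs"
  define c where "c = last cs"
  define I where "I = {i. i < m \<and> E c (hs ! i)}"
  have m: "4 \<le> m" "even m" and dhs: "distinct hs" "hs \<noteq> []" and dcs: "distinct cs" "cs \<noteq> []"
    using hs cs by (auto simp: m_def induced_path_def)
  have finI: "finite I" and neI: "I \<noteq> {}"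
    using att by (auto simp: I_def c_def m_def in_set_conv_nth)
  define i where "i = Min I"
  define j where "j = Max I"
  have iI: "i \<in> I" and jI: "j \<in> I" and ij: "i \<le> j"
    and min: "\<And>k. k \<in> I \<Longrightarrow> i \<le> k" and max: "\<And>k. k \<in> I \<Longrightarrow> k \<le> j"
    using finI neI by (auto simp: i_def j_def)
  have im: "i < m" "E c (hs ! i)" and jm: "j < m" "E c (hs ! j)" using iI jI by (auto simp: I_def)
  have c_mem: "c \<in> set cs" and c_hd: "c \<noteq> hd cs"
    using dcs cs(2) by (auto simp: c_def hd_conv_nth last_conv_nth nth_eq_iff_index_eq)
  have ca: "\<not> E c a" "c \<noteq> a" "c \<notin> set hs"
    using cs_a[OF c_mem] c_hd adj_commute cs(3,4) c_mem by auto
  have hadj: "E (hs ! k) (hs ! l) \<longleftrightarrow> l = Suc k" if "k < l" "l < m" for k l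
    using induced_pathD[OF hs(1), of k l] that by (simp add: m_def)
  have a_adj: "E a (hs ! k) \<longleftrightarrow> k = 0 \<or> Suc k = m" if "k < m" for k
    using a(2)[of "hs ! k"] that dhs by (auto simp: m_def nth_eq_last_iff nth_eq_hd_iff)
  have hneq: "hs ! k = hs ! l \<longleftrightarrow> k = l" if "k < m" "l < m" for k l
    using that dhs by (simp add: m_def nth_eq_iff_index_eq)
  have memh: "hs ! k \<in> set hs" if "k < m" for k using that by (simp add: m_def)
  \<comment> \<open>If \<open>c\<close> had a single neighbour on \<open>hs\<close>, that vertex
    would be the centre of a claw formed by \<open>c\<close> and its two neighbours on the hole
    \<open>a # hs\<close>.\<close>
  have "i < j"
  proof (rule ccontr)
    assume "\<not> i < j"
    then have "i = j" using ij by simp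
    then have only: "E c (hs ! k) \<longleftrightarrow> k = i" if "k < m" for k
      using that im min[of k] max[of k] by (auto simp: I_def)
    define u where "u = (if i = 0 then a else hs ! (i - 1))"
    define w where "w = (if Suc i = m then a else hs ! Suc i)"
    have "E (hs ! i) u"
    proof (cases "i = 0")
      case True then show ?thesis using a_adj[of 0] m adj_commute by (auto simp: u_def)
    next
      case False then show ?thesis using hadj[of "i - 1" i] im adj_commute by (auto simp: u_def)
    qed
    moreover have "E (hs ! i) w"
    proof (cases "Suc i = m")
      case True then show ?thesis using a_adj[of i] im adj_commute by (auto simp: w_def)
    next
      case False then show ?thesis using hadj[of i "Suc i"] im by (auto simp: w_def)
    qed
    moreover have "E (hs ! i) c" using im adj_commute by blast
    moreover have "u \<noteq> w \<and> u \<noteq> c \<and> w \<noteq> c"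
      using a(1) memh ca hneq im m by (auto simp: u_def w_def)
    moreover have "\<not> E c u \<and> \<not> E c w"
      using only ca im by (auto simp: u_def w_def)
    moreover have "\<not> E u w"
      using hadj[of "i - 1" "Suc i"] a_adj[of "Suc i"] a_adj[of "i - 1"] im m adj_commute
      by (auto simp: u_def w_def split: if_splits)
    ultimately show False using no_claw[of "hs ! i" u w c] adj_commute by blast
  qed
  have hd_cs': "E (hd cs) (hs ! k) \<longleftrightarrow> k = 0" if "k < m" for k
    using hd_cs[OF memh[OF that]] that dhs by (auto simp: m_def nth_eq_hd_iff)
  have cross: "E x (hs ! k) \<longleftrightarrow> (x = c \<and> k \<in> I) \<or> (x = hd cs \<and> k = 0)" if "x \<in> set cs" "k < m" for x k
    using that inner[OF that(1) _ _ memh[OF that(2)]] hd_cs'[of k] c_hd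
    by (auto simp: I_def c_def)
  define l where "l = length cs"
  have l: "2 \<le> l" using cs by (simp add: l_def)
  \<comment> \<open>\<open>cs\<close> followed by \<open>hs\<close> from index \<open>i\<close> back
    to \<open>0\<close> closes a hole of length \<open>l + Suc i\<close>. For \<open>l = 2\<close>
    and \<open>i = 0\<close> it is only a triangle, but 3 is odd as well.\<close>
  have par1: "odd (l + Suc i)"
  proof (cases "l = 2 \<and> i = 0")
    case False
    define ys where "ys = rev (take (Suc i) hs)"
    have y: "length ys = Suc i" "set ys \<subseteq> set hs" using im by (auto simp: ys_def m_def dest: in_set_takeD)
    have "induced_cycle E (cs @ ys)"
    proof (rule induced_cycle_append)
      show "induced_path E ys" unfolding ys_def
        by (intro induced_path_rev induced_path_take hs(1) adj_sym)
      show "ys \<noteq> []" using y by auto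
      show "set cs \<inter> set ys = {}" using cs(3) y by auto
      show "4 \<le> length cs + length ys" using False l y by (auto simp: l_def)
      fix x y assume x: "x \<in> set cs" and yy: "y \<in> set ys"
      then obtain k where k: "k \<le> i" "y = hs ! k"
        by (auto simp: ys_def in_set_conv_nth less_Suc_eq_le)
      have "hd ys = hs ! i" "last ys = hs ! 0"
        using im m dhs by (auto simp: ys_def hd_rev last_rev take_Suc_conv_app_nth m_def hd_conv_nth)
      then show "E x y \<longleftrightarrow> (x = last cs \<and> y = hd ys) \<or> (x = hd cs \<and> y = last ys)"
        using cross[OF x, of k] k im iI min[of k] hneq[of k i] hneq[of k 0] by (auto simp: c_def)
    qed (use cs dcs in auto)
    from no_even_cycle[OF this] y show ?thesis by (simp add: l_def)
  qed auto
  \<comment> \<open>The second hole consists of \<open>cs\<close>, the part of \<open>hs\<close>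
    from index \<open>j\<close> on, and \<open>a\<close>.\<close>
  have par2: "odd (l + (m - j + 1))"
  proof -
    define ys where "ys = drop j hs @ [a]"
    have drop_nth: "\<exists>k<m. j \<le> k \<and> x = hs ! k" if x: "x \<in> set (drop j hs)" for x
    proof -
      obtain k where "k < m - j" "x = hs ! (j + k)" using x by (auto simp: in_set_conv_nth m_def)
      then show ?thesis by (intro exI[of _ "j + k"]) auto
    qed
    have y: "length ys = m - j + 1" using jm by (auto simp: ys_def m_def)
    have "induced_cycle E (cs @ ys)"
    proof (rule induced_cycle_append)
      show "induced_path E ys" unfolding ys_def
      proof (rule induced_path_snoc)
        show "a \<notin> set (drop j hs)" using a(1) by (meson in_set_dropD)
        show "drop j hs \<noteq> []" using jm by (simp add: m_def)
        fix x assume "x \<in> set (drop j hs)"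
        from drop_nth[OF this] obtain k where k: "k < m" "j \<le> k" "x = hs ! k" by blast
        then show "E x a \<longleftrightarrow> x = last (drop j hs)"
          using a_adj[of k] \<open>i < j\<close> dhs jm adj_commute by (auto simp: m_def nth_eq_last_iff)
      qed (intro induced_path_drop hs(1))
      show "ys \<noteq> []" by (simp add: ys_def)
      show "set cs \<inter> set ys = {}" using cs(3,4) by (auto simp: ys_def dest: in_set_dropD)
      show "4 \<le> length cs + length ys" using l y jm by (auto simp: l_def)
      fix x y assume x: "x \<in> set cs" and yy: "y \<in> set ys"
      have hy: "hd ys = hs ! j" "last ys = a"
        using jm by (auto simp: ys_def m_def hd_append hd_drop_conv_nth)
      show "E x y \<longleftrightarrow> (x = last cs \<and> y = hd ys) \<or> (x = hd cs \<and> y = last ys)"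
      proof (cases "y = a")
        case True
        then show ?thesis using cs_a[OF x] hy adj_commute memh[OF jm(1)] a(1) by auto
      next
        case False
        then have "y \<in> set (drop j hs)" using yy by (auto simp: ys_def)
        from drop_nth[OF this] obtain k where "k < m" "j \<le> k" "y = hs ! k" by blast
        then show ?thesis
          using cross[OF x, of k] hy False \<open>i < j\<close> jI max[of k] hneq[of k j] jm by (auto simp: c_def)
      qed
    qed (use cs dcs in auto)
    from no_even_cycle[OF this] y show ?thesis by (simp add: l_def)
  qed
  \<comment> \<open>Since \<open>m\<close> is even, the two parities make \<open>i\<close> and
    \<open>j\<close> agree modulo 2, so the extreme attachments are not consecutive.\<close>
  have "even (i + j)" using par1 par2 m(2) jm(1) by auto
  then have gap: "i + 2 \<le> j" using \<open>i < j\<close> by (cases "j = Suc i") auto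
  \<comment> \<open>The predecessor of \<open>c\<close> on \<open>cs\<close>. A claw at
    \<open>c\<close> with leaves \<open>q\<close>, \<open>hs ! i\<close>, \<open>hs ! j\<close> is
    avoided only if \<open>q\<close> is the head of \<open>cs\<close> and
    \<open>i = 0\<close>.\<close>
  define q where "q = cs ! (l - 2)"
  have qmem: "q \<in> set cs" using l by (auto simp: q_def l_def)
  have cq: "c = cs ! (l - 1)" using dcs by (simp add: c_def l_def last_conv_nth)
  have qc: "E q c" using induced_pathD[OF cs(1), of "l - 2" "l - 1"] l by (auto simp: q_def cq l_def)
  have "q \<noteq> c" using qc adj_irrefl by blast
  have nij: "hs ! i \<noteq> hs ! j" "\<not> E (hs ! i) (hs ! j)" using gap hneq[of i j] hadj[of i j] im jm by auto
  have "\<not> E q (hs ! j)" using cross[OF qmem jm(1)] \<open>q \<noteq> c\<close> gap by auto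
  then have "E q (hs ! i)"
    using no_claw[of c q "hs ! i" "hs ! j"] qc im jm nij qmem cs(3) memh adj_commute by blast
  then have "q = hd cs" "i = 0" using cross[OF qmem im(1)] \<open>q \<noteq> c\<close> by auto
  then have "l = 2" using l dcs nth_eq_hd_iff[of cs "l - 2"] by (auto simp: q_def l_def)
  \<comment> \<open>With \<open>i = 0\<close> the index \<open>j\<close> is even, whereas
    \<open>m - 1\<close> is odd.\<close>
  moreover have "Suc j \<noteq> m" using \<open>even (i + j)\<close> \<open>i = 0\<close> m by auto
  ultimately show ?thesis using that[of j] im jm gap \<open>i = 0\<close> dhs
    by (auto simp: l_def c_def m_def hd_conv_nth)
qed

text \<open>An induced path \<open>hs\<close> from \<open>s\<close> to \<open>s'\<close> through
  \<open>R\<close> closes a hole with \<open>a\<close>, on which \<open>a\<close>, \<open>p\<close>,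
  \<open>s\<close> form a triangle. The route from \<open>p\<close> over \<open>b\<close> and
  \<open>t\<close> into \<open>R\<close> supplies a path attached to this hole, so
  \<open>triangle_path_attachment\<close> leaves only the single-edge case, where a claw
  appears.\<close>

lemma no_triangle_at_boundary_pair:
  assumes RV: "R \<subseteq> V" and conn: "connected_set R"
    and ab: "a \<in> outside R" "b \<in> outside R"
    and cover: "boundary R \<subseteq> nbhd a \<union> nbhd b"
    and s: "s \<in> boundary R" "s' \<in> boundary R" "E a s" "E a s'" "s \<noteq> s'" "\<not> E s s'"
      "\<not> E b s" "\<not> E b s'"
    and t: "t \<in> boundary R" "\<not> E a t"
    and p: "p \<in> outside R" "E a p" "E p s" "E p p2" "p2 \<in> outside R - nbhd a"
      "(restr E (outside R - nbhd a))\<^sup>*\<^sup>* p2 b"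
  shows False
proof -
  have b: "b \<in> outside R - nbhd a" using rtranclp_restr_mem[OF p(6,5)] .
  have ob: "x \<noteq> y" if "x \<in> outside R" "y \<in> boundary R \<union> R" for x y
    using that by (auto simp: outside_def)
  have br: "x \<noteq> y" if "x \<in> boundary R" "y \<in> R" for x y
    using that by (auto simp: boundary_def)
  have ta: "t \<notin> nbhd a" using t ob[OF ab(1), of t] by (auto simp: nbhd_def)
  have bt: "E b t" using cover t ta ob[OF ab(2), of t] by (auto simp: nbhd_def)
  have aR: "\<not> E a x" "x \<noteq> a" if "x \<in> R" for x
    using outside_not_adj[OF ab(1) that] ob[OF ab(1), of x] that by auto
  have bR: "\<not> E b x" "x \<noteq> b" if "x \<in> R" for x
    using outside_not_adj[OF ab(2) that] ob[OF ab(2), of x] that by auto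
  have p2a: "\<not> E a p2" "p2 \<noteq> a" using p(5) by (auto simp: nbhd_def)
  obtain r where r: "r \<in> R" "E s r" using s(1) by (auto simp: boundary_def)
  obtain r' where r': "r' \<in> R" "E s' r'" using s(2) by (auto simp: boundary_def)
  obtain q where q: "q \<in> R" "E t q" using t(1) by (auto simp: boundary_def)
  \<comment> \<open>Otherwise \<open>a\<close>, \<open>p2\<close> and a neighbour of
    \<open>x\<close> in \<open>R\<close> are the leaves of a claw at \<open>x\<close>.\<close>
  have p2_not: "\<not> E p2 x" if x: "x \<in> boundary R" "E a x" for x
  proof
    assume "E p2 x"
    obtain y where y: "y \<in> R" "E x y" using x(1) by (auto simp: boundary_def)
    have "p2 \<noteq> y" "\<not> E p2 y" using p(5) y outside_not_adj[of p2 R y] ob[of p2 y] by auto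
    then show False
      using no_claw[of x a p2 y] y \<open>E p2 x\<close> x(2) p2a aR[of y] adj_commute by blast
  qed
  \<comment> \<open>This edge would create a claw at \<open>p\<close> with leaves \<open>p2\<close>,
    \<open>s\<close>, \<open>s'\<close>.\<close>
  have ps': "\<not> E p s'"
  proof
    assume "E p s'"
    moreover have "p2 \<noteq> s" "p2 \<noteq> s'" using p(5) ob s(1,2) by auto
    ultimately show False using no_claw[of p p2 s s'] p(3,4) s p2_not by blast
  qed
  define Y where "Y = insert s (insert s' R)"
  have "(restr E Y)\<^sup>*\<^sup>* r r'"
    by (rule restr_mono[of E R]) (use conn r r' in \<open>auto simp: connected_set_def Y_def\<close>)
  moreover have "restr E Y s r" "restr E Y r' s'"
    using r r' adj_commute by (auto simp: restr_def Y_def)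
  ultimately have "(restr E Y)\<^sup>*\<^sup>* s s'"
    by (simp add: converse_rtranclp_into_rtranclp rtranclp.rtrancl_into_rtrancl)
  then obtain hs where hs: "hs \<noteq> []" "hd hs = s" "last hs = s'" "set hs \<subseteq> Y" "induced_path E hs"
    using shortest_path[of E Y s s' "{s'}"] by (auto simp: Y_def)
  have dhs: "distinct hs" using hs(5) by (simp add: induced_path_def)
  have "length hs \<noteq> 1" using hs s(5) by (cases hs) auto
  moreover have "length hs \<noteq> 2"
  proof
    assume "length hs = 2"
    then have "E (hs ! 0) (hs ! 1)" "hs ! 0 = s" "hs ! 1 = s'"
      using hs induced_pathD[OF hs(5), of 0 1] by (auto simp: hd_conv_nth last_conv_nth)
    then show False using s(6) by simp
  qed
  moreover have "length hs \<noteq> 0" using hs(1) by simp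
  ultimately have len3: "3 \<le> length hs" by linarith
  have hsR: "hs ! k \<in> R" if "0 < k" "Suc k < length hs" for k
  proof -
    have "hs ! k \<noteq> s" "hs ! k \<noteq> s'"
      using that nth_eq_hd_iff[OF dhs, of k] nth_eq_last_iff[OF dhs, of k] hs by auto
    moreover have "hs ! k \<in> Y" using that by (intro subsetD[OF hs(4)] nth_mem) simp
    ultimately show ?thesis by (simp add: Y_def)
  qed
  have YS: "Y \<subseteq> R \<union> boundary R" using s by (auto simp: Y_def)
  have out_hs: "x \<notin> set hs" if "x \<in> outside R" for x
    using ob[OF that] hs(4) YS by blast
  have a_hs: "E a h \<longleftrightarrow> h = hd hs \<or> h = last hs" if "h \<in> set hs" for h
    using that hs s aR by (auto simp: Y_def)
  have "induced_cycle E ([a] @ hs)"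
  proof (rule induced_cycle_append)
    show "induced_path E [a]" by (simp add: induced_path_def)
    show "4 \<le> length [a] + length hs" using len3 by simp
    show "E x y \<longleftrightarrow> (x = last [a] \<and> y = hd hs) \<or> (x = hd [a] \<and> y = last hs)"
      if "x \<in> set [a]" "y \<in> set hs" for x y
      using that a_hs by auto
  qed (use hs out_hs[OF ab(1)] in auto)
  \<comment> \<open>The hole has one vertex more than \<open>hs\<close>; the resulting parity also
    rules out length 3.\<close>
  from no_even_cycle[OF this] have ev: "even (length hs)" by simp
  with len3 have len4: "4 \<le> length hs" by (cases "length hs = 3") auto
  \<comment> \<open>\<open>X\<close> keeps the path off the hole and, after its first vertex
    \<open>p\<close>, away from \<open>a\<close>. Stopping at the first vertex of \<open>T\<close>
    keeps its inner vertices unattached to \<open>hs\<close>.\<close>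
  define X where "X = insert p (V - set hs - nbhd a)"
  define T where "T = {c. c \<noteq> p \<and> (\<exists>h\<in>set hs. E c h)}"
  \<comment> \<open>A route from \<open>b\<close> over \<open>t\<close> into \<open>R\<close> that
    misses \<open>nbhd a\<close>; it is cut just before it first meets \<open>hs\<close>.\<close>
  define Z where "Z = insert b (insert t R)"
  have "(restr E Z)\<^sup>*\<^sup>* q (hs ! 1)"
    by (rule restr_mono[of E R]) (use conn q hsR[of 1] len4 in \<open>auto simp: connected_set_def Z_def\<close>)
  moreover have "restr E Z b t" "restr E Z t q" using q bt by (auto simp: restr_def Z_def)
  ultimately have "(restr E Z)\<^sup>*\<^sup>* b (hs ! 1)" by (simp add: converse_rtranclp_into_rtranclp)
  moreover have "b \<in> Z" "b \<notin> set hs" "hs ! 1 \<in> set hs"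
    using out_hs[OF ab(2)] len4 by (auto simp: Z_def)
  ultimately obtain u v where u: "(restr E (Z - set hs))\<^sup>*\<^sup>* b u" "u \<in> Z - set hs" "v \<in> set hs" "E u v"
    by (auto elim: first_entry)
  have Za: "Z \<inter> nbhd a = {}" using b ta aR by (auto simp: Z_def nbhd_def)
  have "t \<in> V" using t by (auto simp: boundary_def)
  moreover have "b \<in> V" using ab by (auto simp: outside_def)
  ultimately have ZX: "Z - set hs \<subseteq> X" using RV Za by (auto simp: X_def Z_def)
  have oX: "outside R - nbhd a \<subseteq> X" using out_hs by (auto simp: X_def outside_def)
  have "(restr E X)\<^sup>*\<^sup>* p2 b" by (rule restr_mono[OF p(6) oX])
  moreover have "(restr E X)\<^sup>*\<^sup>* b u" by (rule restr_mono[OF u(1) ZX])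
  moreover have "restr E X p p2" using p oX by (auto simp: restr_def X_def)
  ultimately have "(restr E X)\<^sup>*\<^sup>* p u" by (simp add: converse_rtranclp_into_rtranclp rtranclp_trans)
  moreover have "u \<in> T" using u Za p(2) by (auto simp: T_def nbhd_def)
  moreover have "p \<in> X" by (simp add: X_def)
  ultimately obtain cs where cs: "cs \<noteq> []" "hd cs = p" "last cs \<in> T" "set cs \<subseteq> X"
      "set (butlast cs) \<inter> T = {}" "induced_path E cs"
    using shortest_path[of E X p u T] by metis
  have "length cs \<noteq> 1" using cs(1-3) by (cases cs) (auto simp: T_def)
  then have len2: "2 \<le> length cs" using cs(1) by (cases cs) (auto simp: Suc_le_eq)
  have p_hs: "E p h \<longleftrightarrow> h = hd hs" if "h \<in> set hs" for h
    using that hs(2,4) p(3) ps' outside_not_adj[OF p(1)] by (auto simp: Y_def)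
  have pa: "p \<noteq> a" using p(2) adj_irrefl by blast
  show False
  proof (rule triangle_path_attachment[OF hs(5) ev len4 out_hs[OF ab(1)] a_hs cs(6) len2])
    show "set cs \<inter> set hs = {}" using cs(4) out_hs[OF p(1)] by (auto simp: X_def)
    show "a \<notin> set cs" using cs(4) pa by (auto simp: X_def nbhd_def)
    show "E a c \<longleftrightarrow> c = hd cs" if "c \<in> set cs" for c
      using that cs(2,4) p(2) by (auto simp: X_def nbhd_def)
    show "E (hd cs) h \<longleftrightarrow> h = hd hs" if "h \<in> set hs" for h
      using p_hs[OF that] cs(2) by simp
    show "\<not> E c h" if c: "c \<in> set cs" "c \<noteq> hd cs" "c \<noteq> last cs" "h \<in> set hs" for c h
    proof -
      have "c \<in> set (butlast cs)"
        using c(1,3) cs(1) by (cases cs rule: rev_cases) auto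
      then have "c \<notin> T" using cs(5) by auto
      then show ?thesis using c cs(2) by (auto simp: T_def)
    qed
    show "\<exists>h\<in>set hs. E (last cs) h" using cs(3) by (auto simp: T_def)
  next
    \<comment> \<open>Here \<open>cs\<close> is the single edge from \<open>p\<close> to
      \<open>c\<close>. As \<open>c\<close> is adjacent to a vertex of \<open>R\<close> but not to
      \<open>a\<close>, it is a boundary vertex dominated by \<open>b\<close>, and \<open>b\<close>,
      \<open>s\<close>, \<open>hs ! j\<close> are the leaves of a claw at \<open>c\<close>.\<close>
    fix j assume j: "length cs = 2" "E (last cs) (hd hs)" "E (last cs) (hs ! j)" "2 \<le> j" "Suc j < length hs"
    define c where "c = last cs"
    have "c = cs ! 1" "p = cs ! 0" using j(1) cs(1,2) by (auto simp: c_def last_conv_nth hd_conv_nth)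
    then have pc: "E p c" using induced_pathD[OF cs(6), of 0 1] j(1) by simp
    have hj: "hs ! j \<in> R" using hsR[of j] j by simp
    have "c \<in> boundary R"
      using hj j(3) pc outside_not_adj[OF p(1), of c] adj_V[of c "hs ! j"]
      by (auto simp: boundary_def c_def)
    moreover have "c \<notin> nbhd a"
      using subsetD[OF cs(4) last_in_set[OF cs(1)]] cs(3) by (auto simp: X_def T_def c_def)
    ultimately have "E b c" using cover ob[OF ab(2), of c] by (auto simp: nbhd_def)
    moreover have "\<not> E s (hs ! j)"
      using induced_pathD[OF hs(5), of 0 j] j hs(1,2) by (auto simp: hd_conv_nth)
    moreover have "s \<noteq> hs ! j" "b \<noteq> s" "b \<noteq> hs ! j" "\<not> E b (hs ! j)"
      using br[OF s(1) hj] ob[OF ab(2)] s(1) bR[OF hj] by auto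
    ultimately show False
      using no_claw[of c b s "hs ! j"] j(2,3) s(7) hs(2) adj_commute unfolding c_def by blast
  qed
qed

end

section \<open>Two cops\<close>

text \<open>Backward induction with the cops to move, \<open>t\<close> bounding their remaining
  moves. Capture counts after a cop move or when the robber ends his move on a cop, in accordance
  with \<open>caught_in_round\<close>.\<close>

fun win :: "('a \<Rightarrow> 'a \<Rightarrow> bool) \<Rightarrow> nat \<Rightarrow> 'a list \<Rightarrow> 'a \<Rightarrow> bool" where
  "win M 0 C r \<longleftrightarrow> r \<in> set C"
| "win M (Suc t) C r \<longleftrightarrow> r \<in> set C \<or>
     (\<exists>C'. list_all2 M C C' \<and> (r \<in> set C' \<or> (\<forall>r'. M r r' \<longrightarrow> win M t C' r')))"

lemma win_Suc: "win M t C r \<Longrightarrow> win M (Suc t) C r"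
proof (induction t arbitrary: C r)
  case (Suc t)
  then show ?case unfolding win.simps(2)[of M "Suc t"] win.simps(2)[of M t C r] by blast
qed simp

lemma win_mono:
  assumes "t \<le> t'" "win M t C r"
  shows "win M t' C r"
  using assms by (induction rule: dec_induct) (auto intro: win_Suc simp del: win.simps)

text \<open>Lets the two cops exchange roles in the case analysis.\<close>

lemma win_swap: "win M t [a, b] r \<Longrightarrow> win M t [b, a] r"
proof (induction t arbitrary: a b r)
  case (Suc t)
  show ?case
  proof (cases "r \<in> {a, b}")
    case False
    then obtain a' b' where "M a a'" "M b b'" "r \<in> {a', b'} \<or> (\<forall>r'. M r r' \<longrightarrow> win M t [a', b'] r')"
      using Suc.prems by (auto simp: list_all2_Cons1)
    then show ?thesis
      using Suc.IH by (auto intro!: exI[of _ "[b', a']"])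
  qed auto
qed auto

lemma relpowp_sym: "symp Q \<Longrightarrow> (Q ^^ n) x y \<Longrightarrow> (Q ^^ n) y x"
proof (induction n arbitrary: x y)
  case (Suc n)
  then obtain z where "(Q ^^ n) x z" "Q z y" by (auto elim: relpowp_Suc_E)
  then show ?case using Suc by (meson relpowp_Suc_I2 sympD)
qed simp

context claw_even_hole_free begin

text \<open>Suppose \<open>s\<close> and \<open>s'\<close> are nonadjacent. A walk from
  \<open>b\<close> to \<open>a\<close> enters \<open>nbhd a\<close> at some \<open>v\<close>, which
  must be adjacent to \<open>s\<close> or \<open>s'\<close> to avoid a claw at \<open>a\<close>.
  This gives a triangle excluded by \<open>no_triangle_at_boundary_pair\<close>.\<close>

lemma boundary_clique:
  assumes RV: "R \<subseteq> V" and conn: "connected_set R"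
    and ab: "a \<in> outside R" "b \<in> outside R" "(restr E (outside R))\<^sup>*\<^sup>* a b"
    and cover: "boundary R \<subseteq> nbhd a \<union> nbhd b"
    and t: "t \<in> boundary R - nbhd a"
    and s: "s \<in> boundary R - nbhd b" "s' \<in> boundary R - nbhd b" "s \<noteq> s'"
  shows "E s s'"
proof (rule ccontr)
  assume ss: "\<not> E s s'"
  have ob: "x \<noteq> y" if "x \<in> outside R" "y \<in> boundary R" for x y
    using that by (auto simp: outside_def)
  have as: "E a s" "E a s'" "\<not> E b s" "\<not> E b s'"
    using s cover ob[OF ab(1)] by (auto simp: nbhd_def)
  have "b \<noteq> a" using t cover by auto
  \<comment> \<open>The leaves \<open>s\<close>, \<open>s'\<close>, \<open>b\<close> would form a
    claw at \<open>a\<close>. Hence the walk from \<open>b\<close> really starts outside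
    \<open>nbhd a\<close>.\<close>
  moreover have "\<not> E a b"
    using no_claw[of a s s' b] as ss s ob[OF ab(2)] adj_commute by blast
  ultimately have b: "b \<notin> nbhd a" by (auto simp: nbhd_def)
  have "(restr E (outside R))\<^sup>*\<^sup>* b a" using ab(3) restr_sym[OF adj_sym] by metis
  then obtain u v where u: "(restr E (outside R - nbhd a))\<^sup>*\<^sup>* b u" "u \<in> outside R - nbhd a"
      "v \<in> outside R \<inter> nbhd a" "E u v"
    using first_entry[of E "outside R" b a "nbhd a"] ab b by (auto simp: nbhd_def)
  have "E a v" using u adj_commute by (auto simp: nbhd_def)
  have ub: "(restr E (outside R - nbhd a))\<^sup>*\<^sup>* u b" using u(1) restr_sym[OF adj_sym] by metis
  have "v \<noteq> s" "v \<noteq> s'" using u(3) ob s by auto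
  then have "E v s \<or> E v s'" using no_claw[of a s s' v] as ss s(3) \<open>E a v\<close> adj_commute by blast
  then show False
  proof
    assume "E v s"
    then show False
      using no_triangle_at_boundary_pair[OF RV conn ab(1,2) cover _ _ as(1,2) s(3) ss as(3,4), of t v u]
        s t u \<open>E a v\<close> ub adj_commute by (auto simp: nbhd_def)
  next
    assume "E v s'"
    then show False
      using no_triangle_at_boundary_pair[OF RV conn ab(1,2) cover _ _ as(2,1) s(3)[symmetric] _ as(4,3), of t v u]
        s t u \<open>E a v\<close> ub adj_commute ss by (auto simp: nbhd_def)
  qed
qed

definition step :: "'a \<Rightarrow> 'a \<Rightarrow> bool" where
  "step u v \<longleftrightarrow> u \<in> V \<and> v \<in> V \<and> (u = v \<or> E u v)"

text \<open>
  The robber is confined to \<open>R\<close> because leaving it takes him next to one of the cops at \<open>a\<close> and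
  \<open>b\<close>. The walk of length \<open>d\<close> joining the cops serves both as a potential and, since it avoids
  \<open>R\<close> and its boundary, as an obstruction to holes.
\<close>
definition cornered :: "'a \<Rightarrow> 'a \<Rightarrow> 'a set \<Rightarrow> nat \<Rightarrow> bool" where
  "cornered a b R d \<longleftrightarrow> R \<subseteq> V \<and> connected_set R \<and> a \<in> outside R \<and> b \<in> outside R \<and>
     boundary R \<subseteq> nbhd a \<union> nbhd b \<and> (restr E (outside R) ^^ d) a b"

lemma cornered_commute: "cornered a b R d \<Longrightarrow> cornered b a R d"
proof -
  have "symp (restr E (outside R))" using adj_sym by (auto simp: restr_def intro!: sympI dest: sympD)
  then show "cornered a b R d \<Longrightarrow> cornered b a R d"
    by (auto simp: cornered_def intro: relpowp_sym)
qed

section \<open>One round of the pursuit\<close>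

lemma nbhd_V: "a \<in> V \<Longrightarrow> nbhd a \<subseteq> V"
  using adj_V' by (auto simp: nbhd_def)

lemma win_adjacent:
  assumes "a \<in> V" "b \<in> V" "r \<in> nbhd a \<union> nbhd b"
  shows "win step (Suc 0) [a, b] r"
proof -
  obtain C' where "list_all2 step [a, b] C'" "r \<in> set C'"
  proof (cases "r \<in> nbhd a")
    case True
    then show ?thesis using assms nbhd_V by (intro that[of "[r, b]"]) (auto simp: step_def nbhd_def)
  next
    case False
    then show ?thesis using assms nbhd_V by (intro that[of "[a, r]"]) (auto simp: step_def nbhd_def)
  qed
  then show ?thesis by auto
qed

text \<open>The new territory is the component of \<open>r\<close> in what the closed neighbourhoods
  leave of \<open>R\<close>. The walk may use \<open>a\<close> and \<open>b\<close> themselves, as a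
  cop may just have stepped onto the boundary of \<open>R\<close>.\<close>

lemma component_cornered:
  assumes RV: "R \<subseteq> V" and r: "r \<in> R - nbhd a - nbhd b" and ab: "a \<in> V" "b \<in> V"
    and cover: "boundary R \<subseteq> nbhd a \<union> nbhd b"
    and walk: "(restr E (insert a (insert b (outside R))) ^^ d) a b"
  obtains R' where "r \<in> R'" "R' \<subseteq> R - nbhd a - nbhd b" "cornered a b R' d"
proof
  let ?X = "R - nbhd a - nbhd b"
  define R' where "R' = {y. (restr E ?X)\<^sup>*\<^sup>* r y}"
  show "r \<in> {y. (restr E ?X)\<^sup>*\<^sup>* r y}" by simp
  show sub: "{y. (restr E ?X)\<^sup>*\<^sup>* r y} \<subseteq> ?X" using rtranclp_restr_mem[OF _ r] by auto
  \<comment> \<open>A boundary vertex of \<open>R'\<close> lying in \<open>R\<close> must be next to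
    or under a cop, since otherwise it would belong to the component.\<close>
  have bd: "boundary R' \<subseteq> boundary R \<union> (R \<inter> (nbhd a \<union> nbhd b))"
  proof
    fix s assume s: "s \<in> boundary R'"
    then obtain y where y: "y \<in> R'" "E s y" "s \<in> V" "s \<notin> R'" by (auto simp: boundary_def)
    then have yX: "y \<in> ?X" using sub by (auto simp: R'_def)
    have "s \<notin> ?X"
    proof
      assume "s \<in> ?X"
      then have "restr E ?X y s" using y yX adj_commute by (auto simp: restr_def)
      then have "s \<in> R'" using y(1) by (auto simp: R'_def intro: rtranclp.rtrancl_into_rtrancl)
      then show False using y by simp
    qed
    then show "s \<in> boundary R \<union> (R \<inter> (nbhd a \<union> nbhd b))" using y yX by (auto simp: boundary_def)
  qed
  have out: "outside R \<subseteq> outside R'"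
    using bd sub by (auto simp: outside_def R'_def)
  have "x \<in> outside R'" if "x \<in> {a, b}" for x
    using that ab sub adj_commute by (auto simp: outside_def boundary_def R'_def nbhd_def)
  then have abo: "a \<in> outside R'" "b \<in> outside R'" by auto
  have conn: "connected_set R'"
    unfolding connected_set_def
  proof (intro ballI)
    fix x y assume xy: "x \<in> R'" "y \<in> R'"
    have *: "(restr E R')\<^sup>*\<^sup>* r z" if "(restr E ?X)\<^sup>*\<^sup>* r z" for z
      using that
    proof (induction rule: rtranclp_induct)
      case (step y z)
      then have "y \<in> R'" "z \<in> R'" by (auto simp: R'_def intro: rtranclp.rtrancl_into_rtrancl)
      then have "restr E R' y z" using step by (auto simp: restr_def)
      then show ?case using step by (metis rtranclp.rtrancl_into_rtrancl)
    qed simp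
    have "(restr E R')\<^sup>*\<^sup>* r x" "(restr E R')\<^sup>*\<^sup>* r y" using xy * unfolding R'_def by blast+
    then show "(restr E R')\<^sup>*\<^sup>* x y" using restr_sym[OF adj_sym, of R' r x] by (metis rtranclp_trans)
  qed
  have "(restr E (outside R') ^^ d) a b"
    using walk by (rule relpowp_mono[rotated]) (use out abo in \<open>auto simp: restr_def\<close>)
  then have "cornered a b R' d"
    unfolding cornered_def using abo conn sub RV bd cover by (auto simp: R'_def)
  then show "cornered a b {y. (restr E ?X)\<^sup>*\<^sup>* r y} d" by (simp add: R'_def)
qed

text \<open>A robber ending the round within reach of a cop is caught by the next move, which
  \<open>1 \<le> n\<close> provides. Otherwise he is still in \<open>R\<close>, whose boundary the
  new positions dominate, and \<open>component_cornered\<close> applies.\<close>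

lemma cornered_advance:
  assumes c: "cornered a b R d" and r: "r \<in> R"
    and a': "a' \<in> nbhd a" "b' \<in> nbhd b" and cover: "boundary R \<subseteq> nbhd a' \<union> nbhd b'"
    and walk: "(restr E (insert a' (insert b' (outside R))) ^^ d') a' b'"
    and win: "\<And>R' r'. cornered a' b' R' d' \<Longrightarrow> r' \<in> R' \<Longrightarrow> R' \<subseteq> R - nbhd a' - nbhd b' \<Longrightarrow>
      win step n [a', b'] r'" and n: "1 \<le> n"
  shows "win step (Suc n) [a, b] r"
proof -
  have V: "a \<in> V" "b \<in> V" "R \<subseteq> V" using c by (auto simp: cornered_def outside_def)
  then have V': "a' \<in> V" "b' \<in> V" using a' nbhd_V by auto
  have "win step n [a', b'] r'" if r': "step r r'" for r'
  proof (cases "r' \<in> nbhd a' \<union> nbhd b'")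
    case True
    then have "win step (Suc 0) [a', b'] r'" using V' by (intro win_adjacent)
    then show ?thesis by (rule win_mono[OF n[unfolded One_nat_def]])
  next
    case False
    then have "r' \<in> R" using r r' cover adj_commute by (auto simp: step_def boundary_def)
    then have "r' \<in> R - nbhd a' - nbhd b'" using False by auto
    from component_cornered[OF V(3) this V' cover walk] show ?thesis using win by metis
  qed
  moreover have "step a a'" "step b b'" using V V' a' by (auto simp: step_def nbhd_def)
  ultimately show ?thesis by (auto simp: list_all2_Cons1 intro!: exI[of _ "[a', b']"])
qed

section \<open>The descent on \<open>2 * card R + d\<close>\<close>

lemma no_induced_square:
  assumes "E x y" "E y z" "E z w" "E w x" "x \<noteq> z" "y \<noteq> w" "\<not> E x z" "\<not> E y w"
  shows False
proof -
  have "induced_cycle E [x, y, z, w]"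
    unfolding induced_cycle_def
  proof (intro conjI allI impI)
    show "distinct [x, y, z, w]" using assms adj_irrefl by auto
    fix i j assume "i < j \<and> j < length [x, y, z, w]"
    then have "(i, j) \<in> {(0, 1), (0, 2), (0, 3), (1, 2), (1, 3), (2, 3)}" by auto
    then show "E ([x, y, z, w] ! i) ([x, y, z, w] ! j) \<longleftrightarrow>
        j = Suc i \<or> (i = 0 \<and> Suc j = length [x, y, z, w])"
      using assms adj_commute by (auto simp: numeral_2_eq_2 numeral_3_eq_3)
  qed simp
  from no_even_cycle[OF this] show False by simp
qed

lemma boundary_nonempty:
  assumes "connected_set V" "r \<in> R" "R \<subseteq> V" "a \<in> V - R"
  shows "boundary R \<noteq> {}"
proof -
  have "(restr E V)\<^sup>*\<^sup>* r a" using assms by (auto simp: connected_set_def)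
  moreover have "r \<in> V" "r \<notin> V - R" "a \<in> V - R" using assms by auto
  ultimately obtain u v where "u \<in> V - (V - R)" "v \<in> V \<inter> (V - R)" "E u v"
    by (rule first_entry)
  then have "v \<in> boundary R" using adj_commute[of u v] by (auto simp: boundary_def)
  then show ?thesis by blast
qed

text \<open>A boundary vertex \<open>s\<close> has a neighbour in \<open>R\<close>, and
  \<open>R'\<close> loses it.\<close>

lemma card_less_minus_nbhd:
  assumes "R' \<subseteq> R - nbhd s - B" "s \<in> boundary R" "finite R"
  shows "card R' < card R"
  using assms by (intro psubset_card_mono) (auto simp: boundary_def nbhd_def)

text \<open>The premise \<open>half\<close> sets aside the case where \<open>b\<close> alone
  dominates the boundary; exchanging the cops reduces that case to this one.\<close>

lemma cornered_win_step:
  assumes IH: "\<And>a b R d r. 2 * card R + d < n \<Longrightarrow> cornered a b R d \<Longrightarrow> r \<in> R \<Longrightarrow>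
      win step (2 * card R + d) [a, b] r"
    and conn: "connected_set V" and c: "cornered a b R d" and r: "r \<in> R"
    and n: "n = 2 * card R + d" and half: "boundary R \<subseteq> nbhd a \<or> \<not> boundary R \<subseteq> nbhd b"
  shows "win step n [a, b] r"
proof -
  have R: "R \<subseteq> V" "finite R" "connected_set R" using c finite_V by (auto simp: cornered_def intro: finite_subset)
  have cover: "boundary R \<subseteq> nbhd a \<union> nbhd b" and walk: "(restr E (outside R) ^^ d) a b"
    and out: "a \<in> outside R" "b \<in> outside R" using c by (auto simp: cornered_def)
  have ob: "x \<noteq> y" if "x \<in> outside R" "y \<in> boundary R" for x y
    using that by (auto simp: outside_def)
  have bV: "boundary R \<subseteq> V" by (auto simp: boundary_def)
  have "card R \<noteq> 0" using r R(2) by auto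
  then have n2: "1 \<le> n - 1" "n = Suc (n - 1)" using n by auto
  have advance: "win step n [a, b] r"
    if "a' \<in> nbhd a" "b' \<in> nbhd b" "boundary R \<subseteq> nbhd a' \<union> nbhd b'"
      "(restr E (insert a' (insert b' (outside R))) ^^ d') a' b'"
      "\<And>R'. cornered a' b' R' d' \<Longrightarrow> R' \<subseteq> R - nbhd a' - nbhd b' \<Longrightarrow> 2 * card R' + d' < n" for a' b' d'
  proof -
    have "win step (Suc (n - 1)) [a, b] r"
    proof (rule cornered_advance[OF c r that(1-4) _ n2(1)])
      fix R' r' assume *: "cornered a' b' R' d'" "r' \<in> R'" "R' \<subseteq> R - nbhd a' - nbhd b'"
      have "win step (2 * card R' + d') [a', b'] r'" by (rule IH[OF that(5)[OF *(1,3)] *(1,2)])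
      then show "win step (n - 1) [a', b'] r'" using that(5)[OF *(1,3)] by (auto intro: win_mono[rotated])
    qed
    then show ?thesis using n2 by simp
  qed
  \<comment> \<open>When \<open>a\<close> steps onto \<open>s\<close>, the walk gains one edge, but
    \<open>R\<close> loses at least one vertex, which counts twice.\<close>
  have progress: "win step n [a, b] r"
    if s: "s \<in> boundary R" "E a s" "boundary R \<subseteq> nbhd s \<union> nbhd b" for s
  proof (rule advance[of s b "Suc d"])
    show "s \<in> nbhd a" "b \<in> nbhd b" "boundary R \<subseteq> nbhd s \<union> nbhd b" using s by (auto simp: nbhd_def)
    have "(restr E (insert s (insert b (outside R))) ^^ d) a b"
      using walk by (rule relpowp_mono[rotated]) (auto simp: restr_def)
    moreover have "restr E (insert s (insert b (outside R))) s a"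
      using s out adj_commute by (auto simp: restr_def)
    ultimately show "(restr E (insert s (insert b (outside R))) ^^ Suc d) s b"
      by (meson relpowp_Suc_I2)
    show "2 * card R' + Suc d < n" if "R' \<subseteq> R - nbhd s - nbhd b" for R'
      using card_less_minus_nbhd[OF that s(1) R(2)] n by simp
  qed
  have ne: "boundary R \<noteq> {}"
    using boundary_nonempty[OF conn r R(1), of a] out by (auto simp: outside_def)
  show ?thesis
  proof (cases "boundary R \<subseteq> nbhd a")
    case True
    then have adj: "E a s" if "s \<in> boundary R" for s
      using that ob[OF out(1) that] by (auto simp: nbhd_def)
    show ?thesis
    proof (cases "\<forall>s\<in>boundary R. \<forall>s'\<in>boundary R. s = s' \<or> E s s'")
      case True
      obtain s where s: "s \<in> boundary R" using ne by auto
      then have "boundary R \<subseteq> nbhd s \<union> nbhd b" using True by (auto simp: nbhd_def)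
      then show ?thesis by (rule progress[OF s adj[OF s]])
    next
      case False
      then obtain s s' where s: "s \<in> boundary R" "s' \<in> boundary R" "s \<noteq> s'" "\<not> E s s'" by auto
      show ?thesis
      proof (cases "d = 0")
        case True
        then have [simp]: "b = a" using walk by simp
        show ?thesis
        \<comment> \<open>Both cops stand at \<open>a\<close> and separate to \<open>s\<close> and
          \<open>s'\<close>, joined by the walk of length 2 through \<open>a\<close>.\<close>
        proof (rule advance[of s s' 2])
          show "s \<in> nbhd a" "s' \<in> nbhd b" using s adj by (auto simp: nbhd_def)
          \<comment> \<open>A boundary vertex adjacent to neither would complete a claw at
            \<open>a\<close>.\<close>
          show "boundary R \<subseteq> nbhd s \<union> nbhd s'"
            using no_claw[of a s s'] s adj by (auto simp: nbhd_def)
          have "restr E (insert s (insert s' (outside R))) s a"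
            "restr E (insert s (insert s' (outside R))) a s'"
            using s adj out adj_commute by (auto simp: restr_def)
          then show "(restr E (insert s (insert s' (outside R))) ^^ 2) s s'"
            by (auto simp: numeral_2_eq_2)
          fix R' assume R': "R' \<subseteq> R - nbhd s - nbhd s'"
          obtain k k' where k: "k \<in> R" "E s k" "k' \<in> R" "E s' k'" using s by (auto simp: boundary_def)
          \<comment> \<open>A common neighbour would close the induced square \<open>a\<close>,
            \<open>s\<close>, \<open>k\<close>, \<open>s'\<close>. So \<open>R\<close> loses two
            vertices, and \<open>2 * card R\<close> drops by at least 4 against the new walk length
            2.\<close>
          have "k \<noteq> k'"
          proof
            assume "k = k'"
            then show False
              using no_induced_square[of a s k s'] k s adj[OF s(1)] adj[OF s(2)] adj_commute
                outside_not_adj[OF out(1) k(1)] out(1) by (auto simp: outside_def)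
          qed
          have "R' \<subseteq> R - {k, k'}" using R' k by (auto simp: nbhd_def)
          then have "card R' \<le> card (R - {k, k'})" using R by (intro card_mono) auto
          also have "\<dots> = card R - 2" using k \<open>k \<noteq> k'\<close> by (subst card_Diff_subset) auto
          finally have "card R' \<le> card R - 2" .
          \<comment> \<open>This makes the truncated \<open>card R - 2\<close> a true
            difference.\<close>
          moreover have "card {k, k'} \<le> card R" using k R by (intro card_mono) auto
          ultimately show "2 * card R' + 2 < n" using \<open>k \<noteq> k'\<close> n by auto
        qed
      next
        case False
        then obtain e where d: "d = Suc e" by (cases d) auto
        then obtain b' where b': "(restr E (outside R) ^^ e) a b'" "restr E (outside R) b' b"
          using walk by (auto elim: relpowp_Suc_E)
        show ?thesis
        \<comment> \<open>Since \<open>a\<close> dominates the whole boundary, the other cop is free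
          to follow the walk: \<open>R\<close> need not shrink, but \<open>d\<close> drops.\<close>
        proof (rule advance[of a b' e])
          show "a \<in> nbhd a" "b' \<in> nbhd b" "boundary R \<subseteq> nbhd a \<union> nbhd b'"
            using b' True adj_commute by (auto simp: nbhd_def restr_def)
          show "(restr E (insert a (insert b' (outside R))) ^^ e) a b'"
            using b'(1) by (rule relpowp_mono[rotated]) (auto simp: restr_def)
          fix R' assume "R' \<subseteq> R - nbhd a - nbhd b'"
          then have "card R' \<le> card R" using R by (intro card_mono) auto
          then show "2 * card R' + e < n" using n d by simp
        qed
      qed
    qed
  next
    case False
    then obtain s t where t: "t \<in> boundary R - nbhd a" and s: "s \<in> boundary R - nbhd b"
      using half by auto
    have "(restr E (outside R))\<^sup>*\<^sup>* a b" using walk by (rule relpowp_imp_rtranclp)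
    \<comment> \<open>The boundary vertices missed by \<open>b\<close> form a clique, so
      \<open>a\<close> may step onto one of them while \<open>b\<close> stays.\<close>
    note cl = boundary_clique[OF R(1,3) out this cover t s]
    show ?thesis
    proof (rule progress)
      show "s \<in> boundary R" "E a s" using s cover ob[OF out(1), of s] by (auto simp: nbhd_def)
      show "boundary R \<subseteq> nbhd s \<union> nbhd b" using cl by (auto simp: nbhd_def)
    qed
  qed
qed

lemma cornered_win:
  assumes "connected_set V"
  shows "cornered a b R d \<Longrightarrow> r \<in> R \<Longrightarrow> win step (2 * card R + d) [a, b] r"
proof (induction "2 * card R + d" arbitrary: a b R d r rule: less_induct)
  case less
  show ?case
  proof (cases "boundary R \<subseteq> nbhd a \<or> \<not> boundary R \<subseteq> nbhd b")
    case True
    then show ?thesis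
      using cornered_win_step[of "2 * card R + d" a b R d r] less assms by blast
  next
    case False
    then have "win step (2 * card R + d) [b, a] r"
      using cornered_win_step[of "2 * card R + d" b a R d r] less assms cornered_commute by blast
    then show ?thesis by (rule win_swap)
  qed
qed

text \<open>Both cops start at \<open>u\<close>, which dominates the boundary of
  \<open>V - {u}\<close>, and their walk has length 0. The subtracted one leaves room for the
  placement round.\<close>

lemma two_cops_win:
  assumes "connected_set V" and u: "u \<in> V" and r: "r \<in> V"
  shows "win step (2 * card V - 1) [u, u] r"
proof (cases "r \<in> nbhd u")
  case True
  then have "win step (Suc 0) [u, u] r" using u by (intro win_adjacent) auto
  moreover have "card V \<noteq> 0" using u finite_V by auto
  ultimately show ?thesis by (intro win_mono[of "Suc 0" "2 * card V - 1"]) auto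
next
  case False
  have rr: "r \<in> (V - {u}) - nbhd u - nbhd u" using False r by (auto simp: nbhd_def)
  have "(restr E (insert u (insert u (outside (V - {u})))) ^^ 0) u u" by simp
  moreover have "boundary (V - {u}) \<subseteq> nbhd u \<union> nbhd u" by (auto simp: boundary_def nbhd_def)
  ultimately obtain R' where R': "r \<in> R'" "R' \<subseteq> V - {u} - nbhd u - nbhd u" "cornered u u R' 0"
    using component_cornered[of "V - {u}" r u u 0] rr u by blast
  have "card R' < card V" using R'(2) u finite_V by (intro psubset_card_mono) auto
  moreover have "win step (2 * card R' + 0) [u, u] r" by (rule cornered_win[OF assms(1) R'(3,1)])
  ultimately show ?thesis by (intro win_mono[of "2 * card R' + 0" "2 * card V - 1"]) auto
qed

end

section \<open>Strategies and a single cop\<close>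

text \<open>A positional move that captures or lowers the least winning time. The default is to
  stay, so the reply is legal whenever staying is.\<close>

definition reply :: "('a \<Rightarrow> 'a \<Rightarrow> bool) \<Rightarrow> 'a list \<Rightarrow> 'a \<Rightarrow> 'a list" where
  "reply M C r =
     (let good = (\<lambda>C'. list_all2 M C C' \<and> (r \<in> set C' \<or>
        (\<exists>t. (LEAST t. win M t C r) = Suc t \<and> (\<forall>r'. M r r' \<longrightarrow> win M t C' r'))))
      in if \<exists>C'. good C' then SOME C'. good C' else C)"

lemma reply_legal: "list_all2 M C C \<Longrightarrow> list_all2 M C (reply M C r)"
  unfolding reply_def Let_def by (auto split: if_splits intro: someI2)

text \<open>At an uncaught winning position the least winning time is positive, and
  \<open>reply\<close> selects a first move witnessing it.\<close>

lemma reply_progress: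
  assumes "win M t C r" "r \<notin> set C" "r \<notin> set (reply M C r)"
  shows "\<exists>s<t. \<forall>r'. M r r' \<longrightarrow> win M s (reply M C r) r'"
proof -
  define good where "good C' \<longleftrightarrow> list_all2 M C C' \<and> (r \<in> set C' \<or>
        (\<exists>t. (LEAST t. win M t C r) = Suc t \<and> (\<forall>r'. M r r' \<longrightarrow> win M t C' r')))" for C'
  have least: "win M (LEAST t. win M t C r) C r" "(LEAST t. win M t C r) \<le> t"
    using assms(1) by (auto intro: LeastI Least_le)
  then obtain s where s: "(LEAST t. win M t C r) = Suc s"
    using assms(2) by (cases "LEAST t. win M t C r") auto
  have ex: "\<exists>C'. good C'" using least(1) assms(2) unfolding s good_def by auto
  then have "reply M C r = (SOME C'. good C')" by (simp add: reply_def good_def)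
  then have "good (reply M C r)" using someI_ex[OF ex] by simp
  then show ?thesis using assms(3) s least(2) by (intro exI[of _ s]) (auto simp: good_def)
qed

text \<open>Folding \<open>reply\<close> over the robber's past yields the strategy; the extra round
  is the placement.\<close>

lemma cops_win_within_if_win:
  assumes C: "set C \<subseteq> verts G" and win: "\<And>r. r \<in> verts G \<Longrightarrow> win (stay_or_move G) t C r"
  shows "cops_win_within G (length C) (Suc t)"
proof -
  let ?M = "stay_or_move G"
  define \<sigma> where "\<sigma> = foldl (reply ?M) C"
  have pos0: "cop_positions \<sigma> r 0 = C" for r by (simp add: cop_positions_def \<sigma>_def)
  have posS: "cop_positions \<sigma> r (Suc i) = reply ?M (cop_positions \<sigma> r i) (r i)" for r i
    by (simp add: cop_positions_def \<sigma>_def)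
  have refl: "list_all2 ?M D D" if "set D \<subseteq> verts G" for D
    using that by (induction D) (auto simp: stay_or_move_def)
  have verts: "set (cop_positions \<sigma> r i) \<subseteq> verts G" for r i
  proof (induction i)
    case (Suc i)
    have "list_all2 ?M (cop_positions \<sigma> r i) (cop_positions \<sigma> r (Suc i))"
      unfolding posS by (rule reply_legal[OF refl[OF Suc]])
    then show ?case by (auto simp: list_all2_conv_all_nth stay_or_move_def in_set_conv_nth)
  qed (simp add: pos0 C)
  have "list_all2 ?M (cop_positions \<sigma> r i) (cop_positions \<sigma> r (Suc i))" for r i
    unfolding posS by (rule reply_legal[OF refl[OF verts]])
  then have strat: "cop_strategy G (length C) \<sigma>"
    unfolding cop_strategy_def using C by (auto simp: pos0)
  have caught: "\<exists>j. j \<le> i + s \<and> caught_in_round \<sigma> r j"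
    if "robber_play G r" "win ?M s (cop_positions \<sigma> r i) (r i)" for r i s
    using that(2)
  proof (induction s arbitrary: i rule: less_induct)
    case (less s)
    let ?D = "cop_positions \<sigma> r i"
    consider "r i \<in> set ?D" | "r i \<notin> set ?D" "r i \<in> set (reply ?M ?D (r i))"
      | "r i \<notin> set ?D" "r i \<notin> set (reply ?M ?D (r i))" by blast
    then show ?case
    proof cases
      case 1
      then show ?thesis by (intro exI[of _ i]) (auto simp: caught_in_round_def)
    next
      case 2
      \<comment> \<open>With no moves left the robber would already be caught, so round
        \<open>Suc i\<close> is within the bound.\<close>
      then have "s \<noteq> 0" using less.prems by (cases s) auto
      then show ?thesis using 2 by (intro exI[of _ "Suc i"]) (auto simp: caught_in_round_def posS)
    next
      case 3
      from reply_progress[OF less.prems this] obtain s' where s': "s' < s"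
        "\<And>r'. ?M (r i) r' \<Longrightarrow> win ?M s' (reply ?M ?D (r i)) r'" by blast
      have "?M (r i) (r (Suc i))" using that(1) by (simp add: robber_play_def)
      then have "win ?M s' (cop_positions \<sigma> r (Suc i)) (r (Suc i))" using s'(2) by (simp add: posS)
      from less.IH[OF s'(1) this] obtain j where "j \<le> Suc i + s'" "caught_in_round \<sigma> r j" by blast
      then show ?thesis using s'(1) by (intro exI[of _ j]) auto
    qed
  qed
  have "\<exists>i<Suc t. caught_in_round \<sigma> r i" if r: "robber_play G r" for r
  proof -
    have "r 0 \<in> verts G" using r by (auto simp: robber_play_def stay_or_move_def)
    then have "win ?M t (cop_positions \<sigma> r 0) (r 0)" using win by (simp add: pos0)
    from caught[OF r this] show ?thesis by (auto simp: less_Suc_eq_le)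
  qed
  with strat show ?thesis unfolding cops_win_within_def by blast
qed

section \<open>Corners, retracts and dismantling\<close>

text \<open>The cop plays on \<open>U - {x}\<close> against the robber's shadow, in which the corner
  \<open>x\<close> is replaced by \<open>y\<close>. When the shadow is caught, the robber is caught
  too or is at \<open>x\<close> with the cop at \<open>y\<close>, within reach of all his moves;
  this costs the extra round.\<close>

lemma win_corner:
  assumes M: "symp M" "M x x" and xy: "x \<in> U" "y \<in> U" "x \<noteq> y" "\<And>v. v \<in> U \<Longrightarrow> M x v \<Longrightarrow> M y v"
  shows "win (restr M (U - {x})) t [c] (if r = x then y else r) \<Longrightarrow> r \<in> U \<Longrightarrow> c \<in> U - {x} \<Longrightarrow>
    win (restr M U) (Suc t) [c] r"
proof (induction t arbitrary: c r)
  case 0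
  have "M y x" using xy M by blast
  then have "restr M U y x" using xy by (simp add: restr_def)
  with 0 show ?case by (auto split: if_splits intro!: exI[of _ "[x]"])
next
  case (Suc t)
  let ?g = "\<lambda>r. if r = x then y else r"
  have "M y x" using xy M by blast
  then have yx: "restr M U y x" using xy by (simp add: restr_def)
  have g: "restr M (U - {x}) (?g u) (?g v)" if "restr M U u v" for u v
    using that xy M \<open>M y x\<close> by (auto simp: restr_def dest: sympD)
  show ?case
  proof (cases "c = ?g r")
    case True
    then have "win (restr M U) (Suc 0) [c] r" using yx by (auto split: if_splits intro!: exI[of _ "[x]"])
    then show ?thesis by (rule win_mono[rotated]) simp
  next
    case False
    then obtain c' where c': "restr M (U - {x}) c c'"
      and alt: "?g r = c' \<or> (\<forall>r'. restr M (U - {x}) (?g r) r' \<longrightarrow> win (restr M (U - {x})) t [c'] r')"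
      using Suc.prems(1) by (auto simp: list_all2_Cons1 simp del: if_split_asm)
    have c'U: "c' \<in> U - {x}" "restr M U c c'" using c' by (auto simp: restr_def)
    have "r = c' \<or> (\<forall>r'. restr M U r r' \<longrightarrow> win (restr M U) (Suc t) [c'] r')"
    proof (cases "?g r = c'")
      case True
      show ?thesis
      proof (cases "r = x")
        case True
        have "win (restr M U) (Suc t) [c'] r'" if "restr M U r r'" for r'
        proof -
          have "restr M U c' r'" using that xy True \<open>?g r = c'\<close> by (auto simp: restr_def)
          then have "win (restr M U) (Suc 0) [c'] r'" by (auto intro!: exI[of _ "[r']"])
          then show ?thesis by (rule win_mono[rotated]) simp
        qed
        then show ?thesis by blast
      qed (use \<open>?g r = c'\<close> in simp)
    next
      case False
      have "win (restr M U) (Suc t) [c'] r'" if r': "restr M U r r'" for r'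
      proof (rule Suc.IH)
        show "win (restr M (U - {x})) t [c'] (?g r')" using alt False g[OF r'] by blast
        show "r' \<in> U" "c' \<in> U - {x}" using r' c'U by (auto simp: restr_def)
      qed
      then show ?thesis by blast
    qed
    then show ?thesis using c'U(2) unfolding win.simps(2)[of _ "Suc t"]
      by (intro disjI2 exI[of _ "[c']"]) auto
  qed
qed

text \<open>
  If a retract \<open>U\<close> had no corner, the robber could stay in \<open>U\<close> and always move away from the
  neighbours of the cop's image under the retraction.
\<close>
lemma retract_has_corner:
  assumes win: "cops_win G 1" and U: "U \<subseteq> verts G" "x0 \<in> U" "x1 \<in> U" "x0 \<noteq> x1"
    and f: "\<And>v. v \<in> verts G \<Longrightarrow> f v \<in> U" "\<And>u. u \<in> U \<Longrightarrow> f u = u"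
      "\<And>u v. stay_or_move G u v \<Longrightarrow> stay_or_move G (f u) (f v)"
  obtains x y where "x \<in> U" "y \<in> U" "x \<noteq> y"
    "\<And>v. v \<in> U \<Longrightarrow> stay_or_move G x v \<Longrightarrow> stay_or_move G y v"
proof (rule ccontr)
  let ?M = "stay_or_move G"
  assume "\<not> thesis"
  then have corner: "\<And>x y. x \<in> U \<Longrightarrow> y \<in> U \<Longrightarrow> x \<noteq> y \<Longrightarrow>
      (\<And>v. v \<in> U \<Longrightarrow> ?M x v \<Longrightarrow> ?M y v) \<Longrightarrow> False" using that by blast
  then have escape: "\<exists>v\<in>U. ?M x v \<and> \<not> ?M y v" if "x \<in> U" "y \<in> U" "x \<noteq> y" for x y
    using corner that by blast
  have refl: "?M v v" if "v \<in> U" for v using that U by (auto simp: stay_or_move_def)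
  obtain \<sigma> where \<sigma>: "cop_strategy G 1 \<sigma>" "\<And>r. robber_play G r \<Longrightarrow> \<exists>i. caught_in_round \<sigma> r i"
    using win by (auto simp: cops_win_def)
  define c0 where "c0 = hd (\<sigma> [])"
  have "robber_play G (\<lambda>_. x0)" using refl U by (auto simp: robber_play_def)
  then have "length (\<sigma> []) = 1" "set (\<sigma> []) \<subseteq> verts G"
    using \<sigma>(1) by (auto simp: cop_strategy_def cop_positions_def)
  then have c0: "c0 \<in> verts G" by (cases "\<sigma> []") (auto simp: c0_def)
  obtain r0 where r0: "r0 \<in> U" "\<not> ?M (f c0) r0"
  \<comment> \<open>One of \<open>x0\<close>, \<open>x1\<close> differs from \<open>f c0\<close>.
    Since \<open>f c0\<close> does not dominate it, some start in \<open>U\<close> is out of reach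
    of \<open>f c0\<close>.\<close>
  proof (cases "f c0 = x0")
    case True
    then show ?thesis using escape[of x1 "f c0"] U that by auto
  next
    case False
    then show ?thesis using escape[of x0 "f c0"] U f(1)[OF c0] that by auto
  qed
  \<comment> \<open>The robber's rule: leave \<open>z\<close> for a vertex out of reach of
    \<open>y\<close>; staying is the default that keeps the move legal.\<close>
  define pick where "pick z y = (if \<exists>w\<in>U. ?M z w \<and> \<not> ?M y w then SOME w. w \<in> U \<and> ?M z w \<and> \<not> ?M y w else z)" for z y
  have pick: "pick z y \<in> U" "?M z (pick z y)" if "z \<in> U" for z y
  proof -
    have "pick z y \<in> U \<and> ?M z (pick z y)"
    proof (cases "\<exists>w\<in>U. ?M z w \<and> \<not> ?M y w")
      case True
      then have "\<exists>w. w \<in> U \<and> ?M z w \<and> \<not> ?M y w" by blast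
      from someI_ex[OF this] True show ?thesis by (simp add: pick_def)
    next
      case False
      then have "pick z y = z" unfolding pick_def by (rule if_not_P)
      then show ?thesis using that refl by simp
    qed
    then show "pick z y \<in> U" "?M z (pick z y)" by auto
  qed
  have pick_away: "\<not> ?M y (pick z y)" if "z \<in> U" "y \<in> U" "z \<noteq> y" for z y
  proof -
    have "\<exists>w. w \<in> U \<and> ?M z w \<and> \<not> ?M y w" using escape[OF that] by blast
    from someI_ex[OF this] show ?thesis using escape[OF that] by (simp add: pick_def)
  qed
  \<comment> \<open>\<open>hist i\<close> lists the positions of rounds \<open>0\<close> to
    \<open>i\<close>. Each extension consults the cop's answer to the history first, because the
    cops move first in a round.\<close>
  define hist where "hist = rec_nat [r0] (\<lambda>_ h. h @ [pick (last h) (f (hd (\<sigma> h)))])"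
  define r where "r i = last (hist i)" for i
  have hist: "map r [0..<Suc i] = hist i" for i
    by (induction i) (auto simp: r_def hist_def)
  have r_Suc: "r (Suc i) = pick (r i) (f (hd (cop_positions \<sigma> r (Suc i))))" for i
    using hist[of i] by (simp add: r_def hist_def cop_positions_def)
  have r_0: "r 0 = r0" by (simp add: r_def hist_def)
  have rU: "r i \<in> U" for i
    by (induction i) (auto simp: r_0 r_Suc r0 pick)
  have play: "robber_play G r"
    using pick rU by (auto simp: robber_play_def r_Suc)
  define c where "c i = hd (cop_positions \<sigma> r i)" for i
  have moves: "list_all2 ?M (cop_positions \<sigma> r i) (cop_positions \<sigma> r (Suc i))"
    and init: "length (cop_positions \<sigma> r 0) = 1" "set (cop_positions \<sigma> r 0) \<subseteq> verts G"
    for i using \<sigma>(1) play by (auto simp: cop_strategy_def)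
  have "length (cop_positions \<sigma> r i) = 1" for i
    by (induction i) (use init(1) list_all2_lengthD[OF moves] in simp_all)
  then have pos: "cop_positions \<sigma> r i = [c i]" for i
    unfolding c_def by (metis One_nat_def length_0_conv length_Suc_conv list.sel(1))
  have cM: "?M (c i) (c (Suc i))" for i using moves[of i] by (simp add: pos)
  then have cV: "c i \<in> verts G" for i by (auto simp: stay_or_move_def)
  have c_0: "c 0 = c0" by (simp add: c_def c0_def cop_positions_def)
  \<comment> \<open>Since \<open>f\<close> preserves moves, an image out of reach at the end of a
    round cannot land on the robber next, so the robber may escape again.\<close>
  have away: "\<not> ?M (f (c i)) (r i)" for i
  proof (induction i)
    case 0
    then show ?case using r0 by (simp add: c_0 r_0)
  next
    case (Suc i)
    then have "r i \<noteq> f (c (Suc i))" using f(3)[OF cM[of i]] by metis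
    then show ?case using pick_away[OF rU f(1)[OF cV]] by (simp add: r_Suc pos)
  qed
  have away': "r i \<noteq> f (c (Suc i))" for i
    using away[of i] f(3)[OF cM[of i]] by metis
  obtain i where "caught_in_round \<sigma> r i" using \<sigma>(2)[OF play] by blast
  then have "r i = c i \<or> (i > 0 \<and> r (i - 1) = c i)" by (auto simp: caught_in_round_def pos)
  then show False
  proof
    assume "r i = c i"
    then show False using away[of i] f(2)[OF rU[of i]] refl[OF rU[of i]] by simp
  next
    assume "i > 0 \<and> r (i - 1) = c i"
    then obtain j where "i = Suc j" "r j = c (Suc j)" by (cases i) auto
    then show False using away'[of j] f(2)[OF rU[of j]] by simp
  qed
qed

text \<open>Induction on \<open>card U\<close>: folding a corner \<open>x\<close> onto a vertex
  \<open>y\<close> that dominates it leaves a smaller retract, and \<open>win_corner\<close> pays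
  one round to put \<open>x\<close> back.\<close>

lemma one_cop_wins_in_retract:
  assumes win: "cops_win G 1" and fin: "finite (verts G)" and sym: "symp (stay_or_move G)"
  shows "U \<subseteq> verts G \<Longrightarrow> U \<noteq> {} \<Longrightarrow> (\<And>v. v \<in> verts G \<Longrightarrow> f v \<in> U) \<Longrightarrow> (\<And>u. u \<in> U \<Longrightarrow> f u = u) \<Longrightarrow>
      (\<And>u v. stay_or_move G u v \<Longrightarrow> stay_or_move G (f u) (f v)) \<Longrightarrow>
      \<exists>c\<in>U. \<forall>r\<in>U. win (restr (stay_or_move G) U) (card U - 1) [c] r"
proof (induction "card U" arbitrary: U f rule: less_induct)
  case less
  let ?M = "stay_or_move G"
  have finU: "finite U" using less.prems fin finite_subset by blast
  obtain x0 where x0: "x0 \<in> U" using less.prems by auto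
  show ?case
  proof (cases "U = {x0}")
    case True
    then show ?thesis by auto
  next
    case False
    then obtain x1 where x1: "x1 \<in> U" "x0 \<noteq> x1" using x0 by auto
    obtain x y where xy: "x \<in> U" "y \<in> U" "x \<noteq> y" "\<And>v. v \<in> U \<Longrightarrow> ?M x v \<Longrightarrow> ?M y v"
      using retract_has_corner[OF win less.prems(1) x0 x1 less.prems(3-5)] by metis
    let ?g = "\<lambda>r. if r = x then y else r"
    have Mx: "?M x x" using xy less.prems(1) by (auto simp: stay_or_move_def)
    have Myx: "?M y x" using xy Mx by blast
    have Myy: "?M y y" using xy less.prems(1) by (auto simp: stay_or_move_def)
    have g: "?M (?g u) (?g v)" if "?M u v" "u \<in> U" "v \<in> U" for u v
      using that xy Myx Myy sym by (auto dest: sympD)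
    have MV: "u \<in> verts G \<and> v \<in> verts G" if "?M u v" for u v using that by (auto simp: stay_or_move_def)
    have "\<exists>c\<in>U - {x}. \<forall>r\<in>U - {x}. win (restr ?M (U - {x})) (card (U - {x}) - 1) [c] r"
    proof (rule less.hyps[of _ "?g \<circ> f"])
      show "card (U - {x}) < card U" using finU xy(1) by (rule card_Diff1_less)
      show "?M ((?g \<circ> f) u) ((?g \<circ> f) v)" if "?M u v" for u v
        using g[OF less.prems(5)[OF that]] less.prems(3) MV[OF that] by simp
    qed (use less.prems(1-4) xy in auto)
    then obtain c where c: "c \<in> U - {x}"
      "\<And>r. r \<in> U - {x} \<Longrightarrow> win (restr ?M (U - {x})) (card (U - {x}) - 1) [c] r" by blast
    have "win (restr ?M U) (card U - 1) [c] r" if r: "r \<in> U" for r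
    proof -
      have "win (restr ?M (U - {x})) (card (U - {x}) - 1) [c] (?g r)" using c(2) r xy by auto
      from win_corner[OF sym Mx xy this r c(1)]
      have "win (restr ?M U) (Suc (card (U - {x}) - 1)) [c] r" by simp
      moreover have "card U = Suc (card (U - {x}))" using card_Suc_Diff1[OF finU xy(1)] by simp
      \<comment> \<open>Otherwise the truncated subtraction would lose a round.\<close>
      moreover have "card (U - {x}) \<noteq> 0" using finU c(1) by auto
      ultimately show ?thesis by simp
    qed
    then show ?thesis using c(1) by blast
  qed
qed

lemma one_cop_wins_within:
  assumes "cops_win G 1" "finite (verts G)" "symp (stay_or_move G)" "verts G \<noteq> {}"
  shows "cops_win_within G 1 (card (verts G))"
proof -
  have "restr (stay_or_move G) (verts G) = stay_or_move G"
    by (auto simp: restr_def stay_or_move_def fun_eq_iff)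
  then obtain c where "c \<in> verts G" "\<And>r. r \<in> verts G \<Longrightarrow> win (stay_or_move G) (card (verts G) - 1) [c] r"
    using one_cop_wins_in_retract[OF assms(1-3) subset_refl assms(4), of id] by auto
  then have "cops_win_within G (length [c]) (Suc (card (verts G) - 1))"
    by (intro cops_win_within_if_win) auto
  moreover have "card (verts G) \<noteq> 0" using assms by auto
  ultimately show ?thesis by simp
qed

section \<open>Components\<close>

lemma induced_dominates_iff:
  assumes "induced_subgraph H G" "u \<in> verts H" "v \<in> verts H"
  shows "u \<rightarrow>\<^bsub>H\<^esub> v \<longleftrightarrow> u \<rightarrow>\<^bsub>G\<^esub> v"
  using assms
  by (auto simp: induced_subgraph_def subgraph_def compatible_def arcs_ends_conv image_iff)

lemma induced_cycle_mono:
  assumes "induced_cycle E xs" "\<And>u v. u \<in> set xs \<Longrightarrow> v \<in> set xs \<Longrightarrow> E u v \<longleftrightarrow> F u v"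
  shows "induced_cycle F xs"
  unfolding induced_cycle_def
proof (intro conjI allI impI)
  fix i j assume ij: "i < j \<and> j < length xs"
  have "E (xs ! i) (xs ! j) \<longleftrightarrow> F (xs ! i) (xs ! j)" using ij by (intro assms(2)) auto
  then show "F (xs ! i) (xs ! j) \<longleftrightarrow> j = Suc i \<or> (i = 0 \<and> Suc j = length xs)"
    using assms(1) ij by (simp add: induced_cycle_def)
qed (use assms(1) in \<open>auto simp: induced_cycle_def\<close>)

lemma (in graph) graph_induced_subgraph:
  assumes "induced_subgraph H G"
  shows "graph H"
  using digraph.graphI[OF digraphI_induced[OF assms] induced_graph_imp_symmetric[OF sym_arcs assms]] .

lemma (in pre_digraph) cas_if_consecutive:
  assumes "p \<noteq> []" "\<And>i. Suc i < length p \<Longrightarrow> head G (p ! i) = tail G (p ! Suc i)"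
  shows "cas (tail G (hd p)) p (head G (last p))"
  using assms
proof (induction p)
  case (Cons e p)
  show ?case
  proof (cases "p = []")
    case False
    have "cas (tail G (hd p)) p (head G (last p))"
      using Cons.IH[OF False] Cons.prems(2) by force
    moreover have "head G e = tail G (hd p)"
      using Cons.prems(2)[of 0] False by (simp add: hd_conv_nth)
    ultimately show ?thesis using False by simp
  qed simp
qed simp

text \<open>Otherwise the subgraph induced on \<open>c\<close>, \<open>x\<close>, \<open>y\<close>,
  \<open>z\<close> is a claw.\<close>

lemma claw_freeD:
  assumes "graph G" "claw_free G"
    and c: "c \<rightarrow>\<^bsub>G\<^esub> x" "c \<rightarrow>\<^bsub>G\<^esub> y" "c \<rightarrow>\<^bsub>G\<^esub> z" "x \<noteq> y" "x \<noteq> z" "y \<noteq> z"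
  shows "x \<rightarrow>\<^bsub>G\<^esub> y \<or> x \<rightarrow>\<^bsub>G\<^esub> z \<or> y \<rightarrow>\<^bsub>G\<^esub> z"
proof (rule ccontr)
  assume nadj: "\<not> ?thesis"
  interpret graph G by fact
  let ?K = "G \<restriction> {c, x, y, z}"
  have sym: "u \<rightarrow>\<^bsub>G\<^esub> v \<longleftrightarrow> v \<rightarrow>\<^bsub>G\<^esub> u" for u v using graph_symmetric by blast
  have irr: "\<not> u \<rightarrow>\<^bsub>G\<^esub> u" for u using adj_not_same by blast
  have ind: "induced_subgraph ?K G"
    by (rule induced_induce) (use c in auto)
  have "arcs_ends ?K = {c} \<times> {x, y, z} \<union> {x, y, z} \<times> {c}"
  proof -
    have "(u, v) \<in> arcs_ends ?K \<longleftrightarrow> u \<in> {c, x, y, z} \<and> v \<in> {c, x, y, z} \<and> u \<rightarrow>\<^bsub>G\<^esub> v" for u v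
      by (auto simp: arcs_ends_conv image_iff)
    moreover have "x \<rightarrow>\<^bsub>G\<^esub> c" "y \<rightarrow>\<^bsub>G\<^esub> c" "z \<rightarrow>\<^bsub>G\<^esub> c"
      "\<not> y \<rightarrow>\<^bsub>G\<^esub> x" "\<not> z \<rightarrow>\<^bsub>G\<^esub> x" "\<not> z \<rightarrow>\<^bsub>G\<^esub> y"
      using c nadj sym by blast+
    ultimately show ?thesis using c nadj irr unfolding set_eq_iff split_paired_All by auto
  qed
  moreover have "c \<notin> {x, y, z}" using c irr by auto
  moreover have "card {x, y, z} = 3" using c by simp
  moreover have "graph ?K" by (rule graph_induced_subgraph[OF ind])
  moreover have "verts ?K = {c} \<union> {x, y, z}" by auto
  moreover have "card {c} = 1" by simp
  ultimately have "K\<^bsub>1,3\<^esub> ?K"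
    unfolding complete_bipartite_digraph_def by (metis disjoint_insert(1) inf_bot_left insert_disjoint(1))
  with ind assms(2) show False unfolding claw_free_def by blast
qed

text \<open>Holes are lists of arcs, so an arc from each vertex to its cyclic successor
  \<open>nxt\<close> is chosen.\<close>

lemma hole_if_induced_cycle:
  assumes "graph G" "induced_cycle (dominates G) xs"
  obtains p where "hole G p" "length p = length xs"
proof -
  interpret graph G by fact
  define n where "n = length xs"
  have d: "distinct xs" "4 \<le> n" and adj: "\<And>i j. i < j \<Longrightarrow> j < n \<Longrightarrow>
      xs ! i \<rightarrow>\<^bsub>G\<^esub> xs ! j \<longleftrightarrow> j = Suc i \<or> (i = 0 \<and> Suc j = n)"
    using assms(2) by (auto simp: induced_cycle_def n_def)
  define nxt where "nxt i = (if Suc i = n then 0 else Suc i)" for i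
  have nxt: "nxt i < n" if "i < n" for i using that d by (auto simp: nxt_def)
  have "\<exists>e\<in>arcs G. tail G e = xs ! i \<and> head G e = xs ! nxt i" if i: "i < n" for i
  proof -
    have "xs ! i \<rightarrow>\<^bsub>G\<^esub> xs ! nxt i"
    proof (cases "Suc i = n")
      case True
      then have "xs ! 0 \<rightarrow>\<^bsub>G\<^esub> xs ! i" using adj[of 0 i] d by auto
      then show ?thesis using True graph_symmetric by (auto simp: nxt_def)
    next
      case False
      then show ?thesis using adj[of i "Suc i"] i by (auto simp: nxt_def)
    qed
    then show ?thesis by (auto simp: arcs_ends_conv)
  qed
  then obtain e where e: "\<And>i. i < n \<Longrightarrow> e i \<in> arcs G \<and> tail G (e i) = xs ! i \<and> head G (e i) = xs ! nxt i"
    by metis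
  define p where "p = map e [0..<n]"
  have lp: "length p = n" "p \<noteq> []" using d by (auto simp: p_def)
  have tails: "map (tail G) p = xs"
    by (rule nth_equalityI) (auto simp: p_def n_def e)
  have "head G (last p) = xs ! 0" using d e[of "n - 1"] by (simp add: p_def last_map nxt_def)
  moreover have "tail G (hd p) = xs ! 0" using d e[of 0] by (simp add: p_def hd_map)
  moreover have "cas (tail G (hd p)) p (head G (last p))"
    by (rule cas_if_consecutive[OF lp(2)]) (simp add: p_def e nxt_def)
  moreover have "set p \<subseteq> arcs G" by (auto simp: p_def e)
  moreover have "xs ! 0 \<in> verts G" using d e[of 0] by (metis bot_nat_0.not_eq_extremum le_zero_eq tail_in_verts zero_neq_numeral)
  ultimately have "awalk (xs ! 0) p (xs ! 0)" by (simp add: awalk_def)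
  moreover have "awalk_verts (xs ! 0) p = xs @ [xs ! 0]"
    using lp(2) tails \<open>head G (last p) = xs ! 0\<close> by (simp add: awalk_verts_conv)
  moreover have "distinct (tl (xs @ [xs ! 0]))" using d by (cases xs) (auto simp: n_def)
  ultimately have "cycle p" using lp(2) by (auto simp: cycle_def)
  moreover have "arcs_ends (G \<restriction> (tail G ` set p))
       \<subseteq> arc_to_ends G ` set p \<union> (arc_to_ends G ` set p)\<inverse>"
  proof (rule subrelI)
    fix u v assume "(u, v) \<in> arcs_ends (G \<restriction> (tail G ` set p))"
    then have "u \<in> tail G ` set p" "v \<in> tail G ` set p" "u \<rightarrow>\<^bsub>G\<^esub> v"
      by (auto simp: arcs_ends_conv)
    moreover have "tail G ` set p = set xs" using tails by (metis list.set_map)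
    ultimately obtain i j where ij: "i < n" "j < n" "u = xs ! i" "v = xs ! j"
      by (auto simp: in_set_conv_nth n_def)
    have ends: "(xs ! k, xs ! nxt k) \<in> arc_to_ends G ` set p" if "k < n" for k
      using that e[OF that] by (force simp: p_def arc_to_ends_def)
    have *: "(xs ! k, xs ! l) \<in> arc_to_ends G ` set p \<union> (arc_to_ends G ` set p)\<inverse>"
      if "k < l" "l < n" "xs ! k \<rightarrow>\<^bsub>G\<^esub> xs ! l" for k l
      using adj[of k l] that ends[of k] ends[of l] by (auto simp: nxt_def split: if_splits)
    have "i \<noteq> j" using \<open>u \<rightarrow>\<^bsub>G\<^esub> v\<close> ij adj_not_same by auto
    then show "(u, v) \<in> arc_to_ends G ` set p \<union> (arc_to_ends G ` set p)\<inverse>"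
      using *[of i j] *[of j i] ij \<open>u \<rightarrow>\<^bsub>G\<^esub> v\<close> graph_symmetric by (cases i j rule: linorder_cases) auto
  qed
  ultimately have "hole G p" using lp d by (simp add: hole_def)
  then show ?thesis using that lp by (simp add: n_def)
qed

section \<open>The game on one component\<close>

context
  fixes G :: "('a, 'b) pre_digraph"
  assumes G: "graph G" "claw_free G" "even_hole_free G"
begin

lemma component_claw_even_hole_free:
  assumes H: "induced_subgraph H G"
  shows "claw_even_hole_free (verts H) (dominates H)"
proof -
  interpret G: graph G by (rule G)
  interpret H: graph H using G.graph_induced_subgraph[OF H] .
  have mem: "u \<in> verts H \<and> v \<in> verts H" if "u \<rightarrow>\<^bsub>H\<^esub> v" for u v
    using that by (auto simp: arcs_ends_conv)
  note iff = induced_dominates_iff[OF H]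
  show ?thesis
  proof
    show "finite (verts H)" by simp
    show "symp (dominates H)" using H.graph_symmetric by (auto intro: sympI)
    show "\<not> x \<rightarrow>\<^bsub>H\<^esub> x" for x using H.adj_not_same by blast
    show "x \<in> verts H" if "x \<rightarrow>\<^bsub>H\<^esub> y" for x y using mem[OF that] by simp
    show "x \<rightarrow>\<^bsub>H\<^esub> y \<or> x \<rightarrow>\<^bsub>H\<^esub> z \<or> y \<rightarrow>\<^bsub>H\<^esub> z"
      if "c \<rightarrow>\<^bsub>H\<^esub> x" "c \<rightarrow>\<^bsub>H\<^esub> y" "c \<rightarrow>\<^bsub>H\<^esub> z" "x \<noteq> y" "x \<noteq> z" "y \<noteq> z" for c x y z
    proof -
      have "c \<in> verts H" "x \<in> verts H" "y \<in> verts H" "z \<in> verts H" using that mem by blast+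
      then show ?thesis
        using claw_freeD[OF G(1,2) _ _ _ that(4-6), of c] that(1-3) by (simp only: iff)
    qed
    show "odd (length xs)" if xs: "induced_cycle (dominates H) xs" for xs
    proof -
      have len: "4 \<le> length xs" using xs by (simp add: induced_cycle_def)
      \<comment> \<open>\<open>induced_cycle\<close> does not mention the vertex set; membership
        follows because each vertex of the cycle has a neighbour on it.\<close>
      have "x \<in> verts H" if x: "x \<in> set xs" for x
      proof -
        obtain i where i: "i < length xs" "x = xs ! i" using x by (auto simp: in_set_conv_nth)
        show ?thesis
        proof (cases "Suc i < length xs")
          case True
          then have "xs ! i \<rightarrow>\<^bsub>H\<^esub> xs ! Suc i" using xs by (auto simp: induced_cycle_def)
          then show ?thesis using mem i by blast
        next
          case False
          then have "xs ! 0 \<rightarrow>\<^bsub>H\<^esub> xs ! i" using xs i len by (auto simp: induced_cycle_def)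
          then show ?thesis using mem i by blast
        qed
      qed
      then have "induced_cycle (dominates G) xs"
        by (intro induced_cycle_mono[OF xs] iff)
      then obtain p where "hole G p" "length p = length xs"
        using hole_if_induced_cycle[OF G(1)] by metis
      then show ?thesis using G(3) unfolding even_hole_free_def by metis
    qed
  qed
qed

text \<open>Excluding zero cops leaves cop number one or two, each with its own time bound.\<close>

lemma component_cops_win:
  assumes "H \<in> pre_digraph.sccs G"
  shows "cops_win_within H 2 (2 * card (verts H))"
    and "cops_win H 1 \<Longrightarrow> cops_win_within H 1 (card (verts H))"
    and "\<not> cops_win H 0"
    and "verts H \<subseteq> verts G"
proof -
  have H: "induced_subgraph H G" "strongly_connected H"
    using assms by (auto simp: pre_digraph.sccs_def)
  interpret G: graph G by (rule G)
  interpret H: graph H using G.graph_induced_subgraph[OF H(1)] .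
  interpret claw_even_hole_free "verts H" "dominates H"
    by (rule component_claw_even_hole_free[OF H(1)])
  have step: "stay_or_move H = step" by (auto simp: fun_eq_iff stay_or_move_def step_def)
  obtain u where u: "u \<in> verts H" using H(2) by (auto simp: strongly_connected_def)
  have "restr (dominates H) (verts H) = dominates H"
    using adj_V adj_V' by (auto simp: restr_def fun_eq_iff)
  then have "connected_set (verts H)"
    using H(2) by (auto simp: connected_set_def strongly_connected_def rtranclp_rtrancl_eq
      dest: reachable_rtranclI)
  then have "cops_win_within H (length [u, u]) (Suc (2 * card (verts H) - 1))"
    using u by (intro cops_win_within_if_win) (auto simp: step simp del: One_nat_def intro: two_cops_win)
  moreover have "card (verts H) \<noteq> 0" using u by auto
  ultimately show "cops_win_within H 2 (2 * card (verts H))" by (simp add: numeral_2_eq_2)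
  have "symp (stay_or_move H)"
    using adj_sym by (auto simp: stay_or_move_def intro!: sympI dest: sympD)
  then show "cops_win_within H 1 (card (verts H))" if "cops_win H 1"
    using one_cop_wins_within[OF that] u by auto
  show "\<not> cops_win H 0"
  proof
    assume "cops_win H 0"
    then obtain \<sigma> where \<sigma>: "cop_strategy H 0 \<sigma>" "\<And>r. robber_play H r \<Longrightarrow> \<exists>i. caught_in_round \<sigma> r i"
      by (auto simp: cops_win_def)
    have play: "robber_play H (\<lambda>_. u)" using u by (simp add: robber_play_def stay_or_move_def)
    have "cop_positions \<sigma> (\<lambda>_. u) i = []" for i
    proof (induction i)
      case 0
      then show ?case using \<sigma>(1) play by (auto simp: cop_strategy_def)
    next
      case (Suc i)
      have "list_all2 (stay_or_move H) (cop_positions \<sigma> (\<lambda>_. u) i) (cop_positions \<sigma> (\<lambda>_. u) (Suc i))"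
        using \<sigma>(1) play unfolding cop_strategy_def by blast
      then show ?case using Suc by simp
    qed
    then show False using \<sigma>(2)[OF play] by (simp add: caught_in_round_def)
  qed
  show "verts H \<subseteq> verts G" using H(1) by (simp add: induced_subgraph_def subgraph_def)
qed

end

section \<open>From the components to the whole graph\<close>

lemma connected_cop_number_le: "cops_win G k \<Longrightarrow> connected_cop_number G \<le> enat k"
  unfolding connected_cop_number_def by (rule Inf_lower) auto

text \<open>A finite infimum in \<open>enat\<close> comes from a nonempty set and, by well-ordering,
  belongs to it.\<close>

lemma connected_cop_number_attained:
  assumes "connected_cop_number G = enat k"
  shows "cops_win G k"
proof -
  let ?A = "{enat k |k. cops_win G k}"
  have "?A \<noteq> {}"
  proof
    assume "?A = {}"
    then show False using assms unfolding connected_cop_number_def by (simp add: top_enat_def)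
  qed
  then have "Inf ?A \<in> ?A" unfolding Inf_enat_def by (auto intro: LeastI)
  then show ?thesis using assms unfolding connected_cop_number_def by auto
qed

theorem theorem1p2:
  fixes G :: "('a, 'b) pre_digraph"
  assumes "graph G"
    and "claw_free G"
    and "even_hole_free G"
  shows "cop_number G \<le> 2 \<and> capture_time G \<le> enat (2 * card (verts G))"
proof -
  have fin: "finite (verts G)"
    using assms(1) by (simp add: graph_def digraph_def fin_digraph.finite_verts)
  have main: "connected_cop_number H \<le> 2 \<and> connected_capture_time H \<le> enat (2 * card (verts G))"
    if "H \<in> pre_digraph.sccs G" for H
  proof -
    note win = component_cops_win[OF assms that]
    have le: "card (verts H) \<le> card (verts G)" using win(4) fin by (rule card_mono[rotated])
    have "cops_win H 2" using win(1) unfolding cops_win_def cops_win_within_def by blast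
    then have n2: "connected_cop_number H \<le> enat 2" by (rule connected_cop_number_le)
    then obtain k where k: "connected_cop_number H = enat k" "k \<le> 2"
      by (cases "connected_cop_number H") auto
    have "cops_win H k" using connected_cop_number_attained[OF k(1)] .
    \<comment> \<open>Capture time is measured with exactly the cop number of the component, so one
      cop and two cops each need their own bound.\<close>
    then have "k = 1 \<and> cops_win H 1 \<or> k = 2" using win(3) k(2) by (cases k rule: nat.exhaust) (auto simp: le_Suc_eq numeral_2_eq_2)
    then obtain t where t: "cops_win_within H k t" "t \<le> 2 * card (verts H)"
      using win(1,2) by fastforce
    have "connected_capture_time H \<le> enat t"
      unfolding connected_capture_time_def using k(1) t(1) by (intro Inf_lower) auto
    also have "\<dots> \<le> enat (2 * card (verts G))" using t(2) le by simp
    finally show ?thesis using n2 by (simp add: numeral_eq_enat)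
  qed
  show ?thesis
    unfolding cop_number_def capture_time_def using main by (auto intro!: SUP_least)
qed

end
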